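(* Let $f$ be a probability density on $\mathbb{R}$ with $$\int f(v)v^2\,dv=1,\qquad H(f|\gamma)<+\infty .$$ Then there exists an entropically $f(v)\,dv$-chaotic sequence $\{\mu^{(N)}\}_{N\in\mathbb{N}}$ of probability measures, $\mu^{(N)}$ on $S^{N-1}(\sqrt N)$.
   Context: $S^{N-1}(\sqrt N)\subset\mathbb{R}^N$ is the sphere of radius $\sqrt N$ centred at $0$, and $\sigma^N$ is the uniform probability measure on it. $\gamma(v)=e^{-v^2/2}/\sqrt{2\pi}$, identified with the measure $\gamma(v)\,dv$. For probability measures $\mu,\nu$ on the same space, $H(\mu|\nu)=\int h\log h\,d\nu$ with $h=d\mu/d\nu$, and $H(\mu|\nu)=+\infty$ if $\mu$ is not absolutely continuous with respect to $\nu$; for a density $f$, $H(f|\gamma)=\int_{\mathbb{R}} f\log(f/\gamma)\,dv$. $P_k\mu^{(N)}$ denotes the marginal of $\mu^{(N)}$ on the first $k$ coordinates $(v_1,\dots,v_k)$. Entropic chaos: for a probability measure $\mu$ on $\mathbb{R}$ and probability measures $\mu^{(N)}$ on $S^{N-1}(\sqrt N)$, the sequence $\{\mu^{(N)}\}$ is entropically $\mu$-chaotic if (i) each $\mu^{(N)}$ is symmetric under interchange of the variables $v_1,\dots,v_N$; (ii) for each fixed positive integer $k$, $P_k\mu^{(N)}\to\mu^{\otimes k}$ weakly against bounded continuous test functions as $N\to\infty$; and (iii) $\lim_{N\to\infty}\frac{H(\mu^{(N)}|\sigma^N)}{N}=H(\mu|\gamma)$. *)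

theory Defs
  imports "HOL-Probability.Probability"
begin

text \<open>
  \<open>\<real>\<^sup>N\<close> with \<open>N\<close> varying is the space of extensional functions on \<open>{..<N}\<close>, with the
  product sigma-algebra; the coordinate \<open>v\<^sub>i\<close> is \<open>x (i - 1)\<close>.
\<close>

definition sqnorm :: "nat \<Rightarrow> (nat \<Rightarrow> real) \<Rightarrow> real" where
  "sqnorm N x = (\<Sum>i<N. (x i)\<^sup>2)"

text \<open>The sphere of radius \<open>sqrt N\<close> about the origin, with its Borel sets.\<close>

definition sphere_space :: "nat \<Rightarrow> (nat \<Rightarrow> real) measure" where
  "sphere_space N =
     restrict_space (PiM {..<N} (\<lambda>_. borel)) {x. sqnorm N x = real N}"

definition lebesgue_ball :: "nat \<Rightarrow> (nat \<Rightarrow> real) measure" where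
  "lebesgue_ball N =
     uniform_measure (PiM {..<N} (\<lambda>_. lborel))
       {x \<in> space (PiM {..<N} (\<lambda>_. lborel)). sqnorm N x \<le> real N}"

text \<open>
  The value at the origin, a null set for \<open>N > 0\<close>, is an arbitrary point of the sphere.
\<close>

definition radial_proj :: "nat \<Rightarrow> (nat \<Rightarrow> real) \<Rightarrow> nat \<Rightarrow> real" where
  "radial_proj N x =
     (\<lambda>i\<in>{..<N}. if sqnorm N x = 0 then 1 else sqrt (real N) * x i / sqrt (sqnorm N x))"

text \<open>
  Normalised surface measure as cone measure: a set \<open>A\<close> of the sphere gets the proportion of
  the volume of the ball that is filled by the cone with base \<open>A\<close> and apex at the origin.
\<close>

definition unif_sphere :: "nat \<Rightarrow> (nat \<Rightarrow> real) measure" where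
  "unif_sphere N = distr (lebesgue_ball N) (sphere_space N) (radial_proj N)"

text \<open>
  Integral with values in \<open>[-\<infinity>, \<infinity>]\<close>. It is meaningful if one of the two parts is finite;
  in the entropies below the negative part is finite, since \<open>t * ln t \<ge> - exp (-1)\<close> and the
  reference measure is a probability measure.
\<close>

definition ext_integral :: "'a measure \<Rightarrow> ('a \<Rightarrow> real) \<Rightarrow> ereal" where
  "ext_integral M g =
     enn2ereal (\<integral>\<^sup>+x. ennreal (g x) \<partial>M) - enn2ereal (\<integral>\<^sup>+x. ennreal (- g x) \<partial>M)"

text \<open>
  \<open>H(\<mu>|\<nu>)\<close> for probability measures on the same space. The library's
  \<^const>\<open>KL_divergence\<close> is real-valued and does not take the value \<open>\<infinity>\<close>.
  The convention \<open>0 log 0 = 0\<close> is built in.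
\<close>

definition rel_entropy :: "'a measure \<Rightarrow> 'a measure \<Rightarrow> ereal" where
  "rel_entropy \<mu> \<nu> =
     (if absolutely_continuous \<nu> \<mu>
      then ext_integral \<nu>
             (\<lambda>x. enn2real (RN_deriv \<nu> \<mu> x) * ln (enn2real (RN_deriv \<nu> \<mu> x)))
      else \<infinity>)"

text \<open>\<open>H(f|\<gamma>)\<close> for a density \<open>f\<close>.\<close>

definition density_entropy :: "(real \<Rightarrow> real) \<Rightarrow> ereal" where
  "density_entropy f =
     ext_integral lborel (\<lambda>v. f v * ln (f v / std_normal_density v))"

definition gauss_measure :: "real measure" where
  "gauss_measure = density lborel (\<lambda>v. ennreal (std_normal_density v))"

definition marginal :: "nat \<Rightarrow> (nat \<Rightarrow> real) measure \<Rightarrow> (nat \<Rightarrow> real) measure" where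
  "marginal k M = distr M (PiM {..<k} (\<lambda>_. borel)) (\<lambda>x. restrict x {..<k})"

definition symmetric_measure :: "nat \<Rightarrow> (nat \<Rightarrow> real) measure \<Rightarrow> bool" where
  "symmetric_measure N M \<longleftrightarrow>
     (\<forall>p. p permutes {..<N} \<longrightarrow> distr M M (\<lambda>x. \<lambda>i\<in>{..<N}. x (p i)) = M)"

definition weakly_converges ::
  "nat \<Rightarrow> (nat \<Rightarrow> (nat \<Rightarrow> real) measure) \<Rightarrow> (nat \<Rightarrow> real) measure \<Rightarrow> bool" where
  "weakly_converges k M L \<longleftrightarrow>
     (\<forall>\<phi> :: (nat \<Rightarrow> real) \<Rightarrow> real.
        continuous_map (product_topology (\<lambda>_. euclideanreal) {..<k}) euclideanreal \<phi> \<longrightarrow>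
        bounded (\<phi> ` topspace (product_topology (\<lambda>_. euclideanreal) {..<k})) \<longrightarrow>
        (\<lambda>N. \<integral>x. \<phi> x \<partial>M N) \<longlonglongrightarrow> (\<integral>x. \<phi> x \<partial>L))"

text \<open>The sequence is indexed by \<open>N \<ge> 1\<close>; \<open>\<mu>N 0\<close> is unconstrained.\<close>

definition entropically_chaotic ::
  "real measure \<Rightarrow> (nat \<Rightarrow> (nat \<Rightarrow> real) measure) \<Rightarrow> bool" where
  "entropically_chaotic \<mu> \<mu>N \<longleftrightarrow>
     prob_space \<mu> \<and> sets \<mu> = sets borel \<and>
     (\<forall>N\<ge>1. prob_space (\<mu>N N) \<and> sets (\<mu>N N) = sets (sphere_space N)) \<and>
     (\<forall>N\<ge>1. symmetric_measure N (\<mu>N N)) \<and>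
     (\<forall>k\<ge>1. weakly_converges k (\<lambda>N. marginal k (\<mu>N N)) (PiM {..<k} (\<lambda>_. \<mu>))) \<and>
     (\<lambda>N. rel_entropy (\<mu>N N) (unif_sphere N) / ereal (real N))
       \<longlonglongrightarrow> rel_entropy \<mu> gauss_measure"

lemma sqnorm_measurable:
  "sqnorm N \<in> borel_measurable (PiM {..<N} (\<lambda>_. lborel))"
  unfolding sqnorm_def by measurable

lemma prob_space_lebesgue_ball: "prob_space (lebesgue_ball N)"
proof -
  interpret product_sigma_finite "\<lambda>_::nat. lborel :: real measure"
    by standard
  define M where "M = PiM {..<N} (\<lambda>_::nat. lborel :: real measure)"
  define B where "B = {x \<in> space M. sqnorm N x \<le> real N}"
  have spM: "space M = PiE {..<N} (\<lambda>_. UNIV)"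
    by (simp add: M_def space_PiM)
  have cube: "emeasure M (PiE {..<N} (\<lambda>_. {-c..c})) = ennreal ((2 * c) ^ N)"
    if "c \<ge> 0" for c :: real
    using that by (simp add: M_def emeasure_PiM ennreal_power)
  have B: "B \<in> sets M"
    using sqnorm_measurable[of N] unfolding B_def M_def by measurable
  have "PiE {..<N} (\<lambda>_. {-1..1}) \<subseteq> B"
  proof
    fix x :: "nat \<Rightarrow> real" assume x: "x \<in> PiE {..<N} (\<lambda>_. {-1..1})"
    have "sqnorm N x \<le> (\<Sum>i<N. 1)"
      unfolding sqnorm_def using x
      by (intro sum_mono) (auto simp: PiE_iff abs_square_le_1 abs_le_iff)
    with x show "x \<in> B" by (auto simp: B_def spM)
  qed
  then have "emeasure M (PiE {..<N} (\<lambda>_. {-1..1})) \<le> emeasure M B"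
    by (rule emeasure_mono) (rule B)
  then have pos: "emeasure M B \<noteq> 0"
    using cube[of 1] by auto
  have "B \<subseteq> PiE {..<N} (\<lambda>_. {- sqrt (real N)..sqrt (real N)})"
  proof
    fix x assume x: "x \<in> B"
    have "x i \<in> {- sqrt (real N)..sqrt (real N)}" if "i < N" for i
    proof -
      have "(x i)\<^sup>2 \<le> sqnorm N x"
        unfolding sqnorm_def using that by (intro member_le_sum) auto
      with x have "(x i)\<^sup>2 \<le> real N" by (auto simp: B_def)
      then have "\<bar>x i\<bar> \<le> sqrt (real N)"
        by (metis real_sqrt_abs real_sqrt_le_iff)
      then show ?thesis by (simp add: abs_le_iff minus_le_iff)
    qed
    with x show "x \<in> PiE {..<N} (\<lambda>_. {- sqrt (real N)..sqrt (real N)})"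
      by (auto simp: B_def spM PiE_iff)
  qed
  then have "emeasure M B \<le> emeasure M (PiE {..<N} (\<lambda>_. {- sqrt (real N)..sqrt (real N)}))"
    by (rule emeasure_mono) (simp add: M_def sets_PiM_I_finite)
  then have fin: "emeasure M B \<noteq> \<infinity>"
    using cube[of "sqrt (real N)"] by (auto simp: top_unique)
  show ?thesis
    using prob_space_uniform_measure[OF pos fin]
    by (simp add: lebesgue_ball_def M_def B_def)
qed

lemma radial_proj_measurable:
  "radial_proj N \<in> measurable (lebesgue_ball N) (sphere_space N)"
proof -
  have 1: "radial_proj N \<in> measurable (PiM {..<N} (\<lambda>_. lborel)) (PiM {..<N} (\<lambda>_. borel))"
    unfolding radial_proj_def sqnorm_def by measurable
  have 2: "sqnorm N (radial_proj N x) = real N" for x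
  proof (cases "sqnorm N x = 0")
    case True
    then have "sqnorm N (radial_proj N x) = (\<Sum>i<N. 1)"
      unfolding sqnorm_def[of N "radial_proj N x"]
      by (intro sum.cong) (auto simp: radial_proj_def)
    then show ?thesis by simp
  next
    case False
    have nn: "sqnorm N x \<ge> 0" by (simp add: sqnorm_def sum_nonneg)
    have "sqnorm N (radial_proj N x) = (\<Sum>i<N. real N / sqnorm N x * (x i)\<^sup>2)"
      unfolding sqnorm_def[of N "radial_proj N x"]
      using False nn
      by (intro sum.cong) (auto simp: radial_proj_def power_mult_distrib power_divide)
    also have "\<dots> = real N / sqnorm N x * sqnorm N x"
      by (simp add: sqnorm_def sum_distrib_left)
    finally show ?thesis using False by simp
  qed
  have "radial_proj N \<in> measurable (PiM {..<N} (\<lambda>_. lborel)) (sphere_space N)"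
    unfolding sphere_space_def by (intro measurable_restrict_space2 1) (auto simp: 2)
  then show ?thesis
    by (simp add: lebesgue_ball_def cong: measurable_cong_sets)
qed

lemma prob_space_unif_sphere: "prob_space (unif_sphere N)"
  unfolding unif_sphere_def
  by (intro prob_space.prob_space_distr prob_space_lebesgue_ball radial_proj_measurable)

lemma sets_unif_sphere: "sets (unif_sphere N) = sets (sphere_space N)"
  by (simp add: unif_sphere_def)

end

theory Submission
  imports Defs
begin

text \<open>
  Let \<open>X\<close> have independent coordinates with density \<open>f\<close>. The law of \<open>sqrt N X / |X|\<close> on the
  sphere, called \<open>projected_law\<close> below, is the chaotic sequence. It is symmetric because the
  coordinates of \<open>X\<close> are exchangeable, and it is chaotic because the second moment of \<open>f\<close> is \<open>1\<close>:
  by the law of large numbers \<open>|X|\<^sup>2 / N\<close> tends to \<open>1\<close>, so the projection hardly moves any fixed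
  number of coordinates (\<open>projected_law_chaotic\<close>). The point is the convergence of the entropy,
  which rests on the variational formula
  \<open>H(\<mu>|\<nu>) = sup\<^sub>\<phi> (\<integral> \<phi> d\<mu> - ln \<integral> exp \<phi> d\<nu>)\<close> over bounded measurable \<open>\<phi>\<close>
  (\<open>donsker_varadhan\<close> and \<open>variational_upper_bound\<close>).

  Upper bound. A standard Gaussian vector has independent direction and radius, and its direction
  is uniform. Hence \<open>\<sigma>\<^sup>N\<close> is the radial projection of \<open>\<gamma>\<^sup>N\<close>, just as the law of \<open>sqrt N X / |X|\<close>
  is that of \<open>f\<^sup>N\<close>. Entropy decreases under maps (\<open>rel_entropy_distr_le\<close>) and is additive on
  products (\<open>rel_entropy_PiM_le\<close>), so the entropy on the sphere is at most \<open>N H(f|\<gamma>)\<close> for every \<open>N \<ge> 1\<close>.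

  Lower bound. In the variational formula on the sphere take \<open>\<phi>(x) = \<Sum>i<N. \<psi> (x i)\<close> with \<open>\<psi>\<close>
  continuous of compact support. Its mean under the projected law is \<open>N (\<integral> \<psi> f + o(1))\<close> by the law
  of large numbers. Its exponential moment under \<open>\<sigma>\<^sup>N\<close> is at most
  \<open>exp (o(N)) (\<integral> exp \<psi> d\<gamma>)\<^sup>N\<close>: by independence of direction and radius it may be computed as a
  Gaussian average over the vectors with \<open>|x|\<^sup>2 / N\<close> close to \<open>1\<close>, an event of probability tending
  to \<open>1\<close> on which the projection changes \<open>\<phi>\<close> by \<open>o(N)\<close> (\<open>sphere_exp_moment_le\<close>). Dividing by \<open>N\<close>,
  the lower limit of the normalised entropies is at least \<open>\<integral> \<psi> f - ln \<integral> exp \<psi> d\<gamma>\<close>, and the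
  supremum over \<open>\<psi>\<close> of these expressions is \<open>H(f|\<gamma>)\<close> (\<open>entropy_lower_bound\<close>).
\<close>

section \<open>Relative entropy and its variational formula\<close>

lemma mult_ln_ge:
  fixes t :: real
  assumes "0 \<le> t"
  shows "- 1 \<le> t * ln t"
proof (cases "t = 0")
  case False
  with assms have "t > 0" by simp
  then have "ln (1 / t) \<le> 1 / t - 1"
    by (intro ln_le_minus_one) simp
  then have "t * ln (1 / t) \<le> t * (1 / t - 1)"
    using \<open>t > 0\<close> by (intro mult_left_mono) auto
  with \<open>t > 0\<close> show ?thesis by (simp add: ln_div right_diff_distrib)
qed simp

text \<open>
  Young's inequality for the conjugate pair \<open>t ln t - t\<close> and \<open>exp a\<close>. Integrated against the
  reference measure with \<open>t\<close> the density and \<open>a\<close> a test function, it is one half of the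
  variational formula for the entropy.
\<close>

lemma entropy_young:
  fixes t a :: real
  assumes "0 \<le> t"
  shows "t * a \<le> t * ln t - t + exp a"
proof (cases "t = 0")
  case False
  with assms have "t > 0" by simp
  then have "1 + (a - ln t) \<le> exp (a - ln t)" by (rule_tac exp_ge_add_one_self)
  then have "t * (1 + (a - ln t)) \<le> t * exp (a - ln t)"
    using \<open>t > 0\<close> by (intro mult_left_mono) auto
  also have "\<dots> = exp a" using \<open>t > 0\<close> by (simp add: exp_diff)
  finally show ?thesis by (simp add: algebra_simps)
qed simp

text \<open>
  Adding the constant \<open>1\<close> makes an integrand such as \<open>h ln h\<close> nonnegative, so that the
  extended integral becomes a single nonnegative one, to which Fatou's lemma applies.
\<close>

lemma (in prob_space) ext_integral_shift:
  assumes [measurable]: "g \<in> borel_measurable M" and ge: "\<And>x. - 1 \<le> g x"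
  shows "ext_integral M g = enn2ereal (\<integral>\<^sup>+x. ennreal (g x + 1) \<partial>M) - 1"
proof -
  let ?n = "\<integral>\<^sup>+x. ennreal (- g x) \<partial>M"
  have split: "ennreal (g x + 1) + ennreal (- g x) = ennreal (g x) + 1" for x
    using ge[of x]
    by (cases "g x \<ge> 0")
       (auto simp: ennreal_plus ennreal_neg simp flip: ennreal_1 ennreal_plus)
  have "?n \<le> (\<integral>\<^sup>+x. 1 \<partial>M)"
    using ge by (intro nn_integral_mono) (simp add: ennreal_le_1 minus_le_iff)
  then have n: "?n \<le> 1" by (simp add: emeasure_space_1)
  have "(\<integral>\<^sup>+x. ennreal (g x + 1) \<partial>M) + ?n = (\<integral>\<^sup>+x. ennreal (g x) + 1 \<partial>M)"
    by (subst nn_integral_add[symmetric]) (auto simp: split)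
  also have "\<dots> = (\<integral>\<^sup>+x. ennreal (g x) \<partial>M) + 1"
    by (simp add: nn_integral_add emeasure_space_1)
  finally have "(\<integral>\<^sup>+x. ennreal (g x + 1) \<partial>M) + ?n = (\<integral>\<^sup>+x. ennreal (g x) \<partial>M) + 1" .
  then have "enn2ereal (\<integral>\<^sup>+x. ennreal (g x + 1) \<partial>M) + enn2ereal ?n
      = enn2ereal (\<integral>\<^sup>+x. ennreal (g x) \<partial>M) + 1"
    by (metis one_ennreal.rep_eq plus_ennreal.rep_eq)
  moreover have "enn2ereal ?n \<le> 1" "0 \<le> enn2ereal ?n"
    using n by (simp_all add: less_eq_ennreal.rep_eq one_ennreal.rep_eq)
  ultimately show ?thesis
    unfolding ext_integral_def
    by (cases "enn2ereal (\<integral>\<^sup>+x. ennreal (g x + 1) \<partial>M)"; cases "enn2ereal ?n";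
        cases "enn2ereal (\<integral>\<^sup>+x. ennreal (g x) \<partial>M)") (auto simp: one_ereal_def)
qed

text \<open>
  The entropy in terms of a real-valued density \<open>h\<close> and of one nonnegative integral, so that no
  difference of possibly infinite quantities remains.
\<close>

lemma rel_entropy_density_form:
  fixes \<mu> \<nu> :: "'a measure"
  assumes \<nu>: "prob_space \<nu>" and \<mu>: "prob_space \<mu>"
    and sets: "sets \<mu> = sets \<nu>" and ac: "absolutely_continuous \<nu> \<mu>"
  obtains h :: "'a \<Rightarrow> real" where
    "h \<in> borel_measurable \<nu>" "\<forall>x. 0 \<le> h x" "\<mu> = density \<nu> (\<lambda>x. ennreal (h x))"
    "\<forall>C. rel_entropy \<mu> \<nu> \<le> ereal C \<longleftrightarrow>
       (\<integral>\<^sup>+x. ennreal (h x * ln (h x) + 1) \<partial>\<nu>) \<le> ennreal (C + 1) \<and> - 1 \<le> C"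
proof -
  interpret \<nu>: prob_space \<nu> by fact
  interpret \<mu>: prob_space \<mu> by fact
  define h where "h x = enn2real (RN_deriv \<nu> \<mu> x)" for x
  have hm: "h \<in> borel_measurable \<nu>" unfolding h_def by measurable
  have "AE x in \<nu>. RN_deriv \<nu> \<mu> x \<noteq> \<infinity>"
    using \<nu>.RN_deriv_finite[OF \<mu>.sigma_finite_measure_axioms ac sets] .
  then have "AE x in \<nu>. RN_deriv \<nu> \<mu> x = ennreal (h x)"
    by eventually_elim (auto simp: h_def less_top)
  then have "density \<nu> (RN_deriv \<nu> \<mu>) = density \<nu> (\<lambda>x. ennreal (h x))"
    using hm by (intro density_cong) auto
  with \<nu>.density_RN_deriv[OF ac sets] have d: "\<mu> = density \<nu> (\<lambda>x. ennreal (h x))" by simp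
  have h0: "0 \<le> h x" for x by (simp add: h_def)
  have "rel_entropy \<mu> \<nu> = ext_integral \<nu> (\<lambda>x. h x * ln (h x))"
    using ac by (simp add: rel_entropy_def h_def)
  also have "\<dots> = enn2ereal (\<integral>\<^sup>+x. ennreal (h x * ln (h x) + 1) \<partial>\<nu>) - 1" (is "_ = enn2ereal ?I - 1")
    using hm h0 by (intro \<nu>.ext_integral_shift mult_ln_ge) auto
  finally have H: "rel_entropy \<mu> \<nu> = enn2ereal ?I - 1" .
  have "enn2ereal ?I - 1 \<le> ereal C \<longleftrightarrow> ?I \<le> ennreal (C + 1) \<and> - 1 \<le> C" for C
  proof (cases ?I)
    case (real r)
    then show ?thesis by (auto simp: one_ereal_def ennreal_le_iff2)
  next
    case top
    then show ?thesis by (simp add: one_ereal_def top_ennreal.rep_eq top_unique)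
  qed
  with H that[OF hm _ d] h0 show thesis by simp
qed

lemma (in prob_space) integrable_bounded:
  fixes g :: "'a \<Rightarrow> real"
  assumes "g \<in> borel_measurable M" "\<And>x. \<bar>g x\<bar> \<le> B"
  shows "integrable M g"
  using assms by (intro integrable_const_bound[of _ B]) auto

lemma (in prob_space) exp_bounded_integral:
  fixes g :: "'a \<Rightarrow> real"
  assumes [measurable]: "g \<in> borel_measurable M" and bd: "\<And>x. \<bar>g x\<bar> \<le> B"
  shows "integrable M (\<lambda>x. exp (g x))" "0 < (\<integral>x. exp (g x) \<partial>M)"
proof -
  show int: "integrable M (\<lambda>x. exp (g x))"
    using bd by (intro integrable_bounded[where B="exp B"]) (auto simp: abs_le_iff)
  have "(\<integral>x. exp (- B) \<partial>M) \<le> (\<integral>x. exp (g x) \<partial>M)"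
    using int bd by (intro integral_mono) (auto simp: abs_le_iff minus_le_iff)
  then have "exp (- B) \<le> (\<integral>x. exp (g x) \<partial>M)" by (simp add: prob_space)
  then show "0 < (\<integral>x. exp (g x) \<partial>M)" using exp_gt_zero[of "- B"] by linarith
qed

lemma finite_rel_entropy_density:
  fixes \<mu> \<nu> :: "'a measure"
  assumes \<nu>: "prob_space \<nu>" and \<mu>: "prob_space \<mu>"
    and sets: "sets \<mu> = sets \<nu>" and ac: "absolutely_continuous \<nu> \<mu>"
    and C: "rel_entropy \<mu> \<nu> \<le> ereal C"
  obtains h :: "'a \<Rightarrow> real" where
    "h \<in> borel_measurable \<nu>" "\<forall>x. 0 \<le> h x" "\<mu> = density \<nu> (\<lambda>x. ennreal (h x))"
    "integrable \<nu> h" "(\<integral>x. h x \<partial>\<nu>) = 1"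
    "integrable \<nu> (\<lambda>x. h x * ln (h x))" "(\<integral>x. h x * ln (h x) \<partial>\<nu>) \<le> C"
proof -
  interpret \<nu>: prob_space \<nu> by fact
  interpret \<mu>: prob_space \<mu> by fact
  obtain h where h[measurable]: "h \<in> borel_measurable \<nu>" and h0': "\<forall>x. 0 \<le> h x"
    and d: "\<mu> = density \<nu> (\<lambda>x. ennreal (h x))"
    and iff: "\<forall>C. rel_entropy \<mu> \<nu> \<le> ereal C \<longleftrightarrow>
       (\<integral>\<^sup>+x. ennreal (h x * ln (h x) + 1) \<partial>\<nu>) \<le> ennreal (C + 1) \<and> - 1 \<le> C"
    using rel_entropy_density_form[OF \<nu> \<mu> sets ac] by blast
  have h0: "0 \<le> h x" for x using h0' by blast
  from iff C have le: "(\<integral>\<^sup>+x. ennreal (h x * ln (h x) + 1) \<partial>\<nu>) \<le> ennreal (C + 1)" and C1: "- 1 \<le> C"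
    by blast+
  have pos: "0 \<le> h x * ln (h x) + 1" for x
    using mult_ln_ge[OF h0[of x]] by simp
  have int1: "integrable \<nu> (\<lambda>x. h x * ln (h x) + 1)"
    using le pos by (intro integrableI_nonneg) (auto simp: le_less_trans less_top[symmetric] top_unique)
  then have "integrable \<nu> (\<lambda>x. (h x * ln (h x) + 1) - 1)" by (rule Bochner_Integration.integrable_diff) simp
  then have int2: "integrable \<nu> (\<lambda>x. h x * ln (h x))" by simp
  have "ennreal (\<integral>x. h x * ln (h x) + 1 \<partial>\<nu>) \<le> ennreal (C + 1)"
    using le pos int1 by (simp add: nn_integral_eq_integral)
  then have "(\<integral>x. h x * ln (h x) + 1 \<partial>\<nu>) \<le> C + 1"
    using C1 by (subst (asm) ennreal_le_iff) auto
  with int2 have A: "(\<integral>x. h x * ln (h x) \<partial>\<nu>) \<le> C" by (simp add: \<nu>.prob_space)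
  have "integrable \<mu> (\<lambda>x. 1 :: real)" by simp
  then have inth: "integrable \<nu> h"
    unfolding d using h0 by (subst (asm) integrable_density) auto
  have "(\<integral>x. 1 \<partial>\<mu>) = (\<integral>x. h x \<partial>\<nu>)"
    unfolding d using h0 by (subst integral_density) auto
  then have h1: "(\<integral>x. h x \<partial>\<nu>) = 1" by (simp add: \<mu>.prob_space)
  from that[OF h h0' d inth h1 int2 A] show thesis .
qed

text \<open>
  Entropy bounds from above how far the \<open>\<mu>\<close>-mean of a test function exceeds its
  \<open>\<nu>\<close>-exponential moment. With \<open>variational_upper_bound\<close> this makes the entropy a supremum
  of expressions that contain no density and therefore push forward along any map.
\<close>

lemma variational_lower_bound:
  fixes \<mu> \<nu> :: "'a measure" and \<phi> :: "'a \<Rightarrow> real"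
  assumes \<nu>: "prob_space \<nu>" and \<mu>: "prob_space \<mu>"
    and sets: "sets \<mu> = sets \<nu>" and ac: "absolutely_continuous \<nu> \<mu>"
    and C: "rel_entropy \<mu> \<nu> \<le> ereal C"
    and \<phi>[measurable]: "\<phi> \<in> borel_measurable \<nu>" and bd: "\<And>x. \<bar>\<phi> x\<bar> \<le> B"
  shows "(\<integral>x. \<phi> x \<partial>\<mu>) \<le> C + (\<integral>x. exp (\<phi> x) \<partial>\<nu>) - 1"
proof -
  interpret \<nu>: prob_space \<nu> by fact
  interpret \<mu>: prob_space \<mu> by fact
  obtain h where h[measurable]: "h \<in> borel_measurable \<nu>" and h0': "\<forall>x. 0 \<le> h x"
    and d: "\<mu> = density \<nu> (\<lambda>x. ennreal (h x))"
    and inth: "integrable \<nu> h" and h1: "(\<integral>x. h x \<partial>\<nu>) = 1"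
    and int2: "integrable \<nu> (\<lambda>x. h x * ln (h x))" and A: "(\<integral>x. h x * ln (h x) \<partial>\<nu>) \<le> C"
    by (rule finite_rel_entropy_density[OF \<nu> \<mu> sets ac C])
  have h0: "0 \<le> h x" for x using h0' by blast
  have "integrable \<mu> \<phi>"
    using bd sets by (intro \<mu>.integrable_bounded[where B=B]) (auto cong: measurable_cong_sets)
  then have int\<phi>: "integrable \<nu> (\<lambda>x. h x * \<phi> x)"
    unfolding d using h0 by (subst (asm) integrable_density) auto
  have inte: "integrable \<nu> (\<lambda>x. exp (\<phi> x))"
    by (rule \<nu>.exp_bounded_integral[OF \<phi> bd])
  have "(\<integral>x. \<phi> x \<partial>\<mu>) = (\<integral>x. h x * \<phi> x \<partial>\<nu>)"
    unfolding d using h0 by (subst integral_density) auto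
  also have "\<dots> \<le> (\<integral>x. h x * ln (h x) - h x + exp (\<phi> x) \<partial>\<nu>)"
    using int2 inth int\<phi> inte h0 by (intro integral_mono entropy_young) auto
  also have "\<dots> = (\<integral>x. h x * ln (h x) \<partial>\<nu>) - 1 + (\<integral>x. exp (\<phi> x) \<partial>\<nu>)"
    using int2 inth inte h1 by simp
  finally show ?thesis using A by simp
qed

text \<open>
  The logarithm arises by shifting the test function by the constant that normalises its
  exponential moment to \<open>1\<close>.
\<close>

lemma donsker_varadhan:
  fixes \<mu> \<nu> :: "'a measure" and \<phi> :: "'a \<Rightarrow> real"
  assumes \<nu>: "prob_space \<nu>" and \<mu>: "prob_space \<mu>"
    and sets: "sets \<mu> = sets \<nu>" and ac: "absolutely_continuous \<nu> \<mu>"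
    and C: "rel_entropy \<mu> \<nu> \<le> ereal C"
    and \<phi>[measurable]: "\<phi> \<in> borel_measurable \<nu>" and bd: "\<And>x. \<bar>\<phi> x\<bar> \<le> B"
  shows "(\<integral>x. \<phi> x \<partial>\<mu>) \<le> C + ln (\<integral>x. exp (\<phi> x) \<partial>\<nu>)"
proof -
  interpret \<nu>: prob_space \<nu> by fact
  interpret \<mu>: prob_space \<mu> by fact
  define Z where "Z = (\<integral>x. exp (\<phi> x) \<partial>\<nu>)"
  have Z: "Z > 0" unfolding Z_def by (rule \<nu>.exp_bounded_integral[OF \<phi> bd])
  have "integrable \<mu> \<phi>"
    using bd sets by (intro \<mu>.integrable_bounded[where B=B]) (auto cong: measurable_cong_sets)
  then have "(\<integral>x. \<phi> x \<partial>\<mu>) - ln Z = (\<integral>x. \<phi> x - ln Z \<partial>\<mu>)"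
    by (simp add: \<mu>.prob_space)
  also have "\<dots> \<le> C + (\<integral>x. exp (\<phi> x - ln Z) \<partial>\<nu>) - 1"
    using bd by (intro variational_lower_bound[OF \<nu> \<mu> sets ac C, where B="B + \<bar>ln Z\<bar>"])
      (auto intro: order_trans[OF abs_triangle_ineq4] add_mono)
  also have "(\<integral>x. exp (\<phi> x - ln Z) \<partial>\<nu>) = 1"
    using Z by (simp add: exp_diff Z_def[symmetric])
  finally show ?thesis by (simp add: Z_def)
qed

text \<open>
  The supremum is approached by \<open>\<phi> = ln h\<close>. This is unbounded, so \<open>h\<close> is truncated to
  \<open>[1/(n+1), n+1]\<close>; since \<open>h ln h\<close> is bounded below on a probability space, Fatou's lemma
  removes the truncation.
\<close>

lemma variational_upper_bound:
  fixes \<mu> \<nu> :: "'a measure"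
  assumes \<nu>: "prob_space \<nu>" and \<mu>: "prob_space \<mu>"
    and sets: "sets \<mu> = sets \<nu>" and ac: "absolutely_continuous \<nu> \<mu>"
    and le: "\<And>\<phi> B. \<phi> \<in> borel_measurable \<nu> \<Longrightarrow> (\<And>x. \<bar>\<phi> x\<bar> \<le> B) \<Longrightarrow>
       (\<integral>x. \<phi> x \<partial>\<mu>) \<le> C + (\<integral>x. exp (\<phi> x) \<partial>\<nu>) - 1"
  shows "rel_entropy \<mu> \<nu> \<le> ereal C"
proof -
  interpret \<nu>: prob_space \<nu> by fact
  interpret \<mu>: prob_space \<mu> by fact
  obtain h where h[measurable]: "h \<in> borel_measurable \<nu>" and h0': "\<forall>x. 0 \<le> h x"
    and d: "\<mu> = density \<nu> (\<lambda>x. ennreal (h x))"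
    and iff: "\<forall>C. rel_entropy \<mu> \<nu> \<le> ereal C \<longleftrightarrow>
       (\<integral>\<^sup>+x. ennreal (h x * ln (h x) + 1) \<partial>\<nu>) \<le> ennreal (C + 1) \<and> - 1 \<le> C"
    using rel_entropy_density_form[OF \<nu> \<mu> sets ac] by blast
  have h0: "0 \<le> h x" for x using h0' by blast
  have C0: "0 \<le> C" using le[of "\<lambda>_. 0" 0] by (simp add: \<nu>.prob_space)
  define t where "t n x = max (1 / real (Suc n)) (min (h x) (real (Suc n)))" for n x
  have tpos: "0 < t n x" for n x
  proof -
    have "0 < 1 / real (Suc n)" by simp
    then show ?thesis unfolding t_def by linarith
  qed
  have tm[measurable]: "t n \<in> borel_measurable \<nu>" for n unfolding t_def by measurable
  have tl: "1 / real (Suc n) \<le> t n x" and tu: "t n x \<le> real (Suc n)" for n x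
  proof -
    have "1 / real (Suc n) \<le> 1" "1 \<le> real (Suc n)" by simp_all
    then have "1 / real (Suc n) \<le> real (Suc n)" by linarith
    then show "1 / real (Suc n) \<le> t n x" "t n x \<le> real (Suc n)" by (simp_all add: t_def)
  qed
  have lnb: "\<bar>ln (t n x)\<bar> \<le> ln (real (Suc n))" for n x
  proof -
    have "ln (1 / real (Suc n)) \<le> ln (t n x)" using tl tpos by (subst ln_le_cancel_iff) auto
    moreover have "ln (t n x) \<le> ln (real (Suc n))" using tu tpos by (subst ln_le_cancel_iff) auto
    ultimately show ?thesis by (simp add: ln_div)
  qed
  have inth: "integrable \<nu> h"
  proof -
    have "integrable \<mu> (\<lambda>x. 1 :: real)" by simp
    then show ?thesis 
    unfolding d using h0 by (subst (asm) integrable_density) auto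
  qed
  have h1: "(\<integral>x. h x \<partial>\<nu>) = 1"
  proof -
    have "(\<integral>x. 1 \<partial>\<mu>) = (\<integral>x. h x \<partial>\<nu>)"
    unfolding d using h0 by (subst integral_density) auto
    then show ?thesis by (simp add: \<mu>.prob_space)
  qed
  have tlim: "(\<lambda>n. t n x) \<longlonglongrightarrow> h x" for x
  proof -
    have a: "(\<lambda>n. 1 / real (Suc n)) \<longlonglongrightarrow> 0" by (rule LIMSEQ_Suc[OF lim_1_over_n])
    have "eventually (\<lambda>n. min (h x) (real (Suc n)) = h x) sequentially"
      using eventually_ge_at_top[of "nat \<lceil>h x\<rceil>"] by eventually_elim (auto simp: min_def; linarith)
    then have "(\<lambda>n. min (h x) (real (Suc n))) \<longlonglongrightarrow> h x" by (rule tendsto_eventually)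
    from tendsto_max[OF a this] show ?thesis using h0[of x] by (simp add: t_def)
  qed
  have inteq: "(\<integral>x. ln (t n x) \<partial>\<mu>) = (\<integral>x. h x * ln (t n x) \<partial>\<nu>)" for n
    unfolding d using h0 by (subst integral_density) auto
  have intl: "integrable \<nu> (\<lambda>x. h x * ln (t n x))" for n
  proof -
    have "integrable \<mu> (\<lambda>x. ln (t n x))"
      using lnb sets by (intro \<mu>.integrable_bounded[where B="ln (real (Suc n))"]) 
       (auto cong: measurable_cong_sets)
    then show ?thesis 
      unfolding d using h0 by (subst (asm) integrable_density) auto
  qed
  \<comment> \<open>Truncation pulls \<open>h x\<close> towards \<open>1\<close>: for \<open>h x < 1\<close> it can
      only raise the logarithm, so the lower bound for \<open>h ln h\<close> survives.\<close>
  have pos: "0 \<le> h x * ln (t n x) + 1" for n x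
  proof (cases "h x \<ge> 1")
    case True
    then have "t n x \<ge> 1" by (auto simp: t_def)
    then show ?thesis using h0[of x] by simp
  next
    case False
    then have "h x \<le> t n x" by (auto simp: t_def)
    then have "h x * ln (h x) \<le> h x * ln (t n x)"
      using h0[of x] by (cases "h x = 0") (auto intro!: mult_left_mono)
    with mult_ln_ge[OF h0[of x]] show ?thesis by linarith
  qed
  have step: "(\<integral>\<^sup>+x. ennreal (h x * ln (t n x) + 1) \<partial>\<nu>) \<le> ennreal (C + (\<integral>x. t n x \<partial>\<nu>))" for n
  proof -
    have "(\<integral>x. ln (t n x) \<partial>\<mu>) \<le> C + (\<integral>x. exp (ln (t n x)) \<partial>\<nu>) - 1"
      using lnb by (intro le) auto
    then have "(\<integral>x. h x * ln (t n x) + 1 \<partial>\<nu>) \<le> C + (\<integral>x. t n x \<partial>\<nu>)"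
      using tpos intl by (simp add: inteq \<nu>.prob_space)
    moreover have "(\<integral>\<^sup>+x. ennreal (h x * ln (t n x) + 1) \<partial>\<nu>) = ennreal (\<integral>x. h x * ln (t n x) + 1 \<partial>\<nu>)"
      using intl pos by (intro nn_integral_eq_integral) auto
    ultimately show ?thesis by (simp add: ennreal_leI)
  qed
  have "(\<lambda>n. \<integral>x. t n x \<partial>\<nu>) \<longlonglongrightarrow> (\<integral>x. h x \<partial>\<nu>)"
  proof (rule integral_dominated_convergence[where w="\<lambda>x. h x + 1"])
    show "AE x in \<nu>. norm (t n x) \<le> h x + 1" for n
    proof (rule AE_I2)
      fix x
      have "1 / real (Suc n) \<le> 1" by simp
      then have "t n x \<le> h x + 1" using h0[of x] unfolding t_def by linarith
      then show "norm (t n x) \<le> h x + 1" using tpos[of n x] by simp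
    qed
  qed (use inth tlim in auto)
  then have "(\<lambda>n. ennreal (C + (\<integral>x. t n x \<partial>\<nu>))) \<longlonglongrightarrow> ennreal (C + 1)"
    unfolding h1 by (intro tendsto_ennrealI tendsto_intros)
  then have lim: "liminf (\<lambda>n. ennreal (C + (\<integral>x. t n x \<partial>\<nu>))) = ennreal (C + 1)"
    by (rule lim_imp_Liminf[OF sequentially_bot])
  have "(\<integral>\<^sup>+x. ennreal (h x * ln (h x) + 1) \<partial>\<nu>)
      = (\<integral>\<^sup>+x. liminf (\<lambda>n. ennreal (h x * ln (t n x) + 1)) \<partial>\<nu>)"
  proof (rule nn_integral_cong)
    fix x
    have "(\<lambda>n. h x * ln (t n x)) \<longlonglongrightarrow> h x * ln (h x)"
    proof (cases "h x = 0")
      case False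
      then show ?thesis by (intro tendsto_intros tlim)
    qed simp
    then have "(\<lambda>n. ennreal (h x * ln (t n x) + 1)) \<longlonglongrightarrow> ennreal (h x * ln (h x) + 1)"
      by (intro tendsto_ennrealI tendsto_add tendsto_const)
    then show "ennreal (h x * ln (h x) + 1) = liminf (\<lambda>n. ennreal (h x * ln (t n x) + 1))"
      by (intro lim_imp_Liminf[OF sequentially_bot, symmetric])
  qed
  also have "\<dots> \<le> liminf (\<lambda>n. \<integral>\<^sup>+x. ennreal (h x * ln (t n x) + 1) \<partial>\<nu>)"
    by (intro nn_integral_liminf) measurable
  also have "\<dots> \<le> liminf (\<lambda>n. ennreal (C + (\<integral>x. t n x \<partial>\<nu>)))"
    by (intro Liminf_mono always_eventually allI step)
  finally show ?thesis using iff C0 lim by auto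
qed

lemma absolutely_continuous_distr:
  assumes T: "T \<in> measurable \<nu> S" and sets: "sets \<mu> = sets \<nu>" and ac: "absolutely_continuous \<nu> \<mu>"
  shows "absolutely_continuous (distr \<nu> S T) (distr \<mu> S T)"
  unfolding absolutely_continuous_def
proof
  fix A assume "A \<in> null_sets (distr \<nu> S T)"
  then have A: "A \<in> sets S" and "emeasure \<nu> (T -` A \<inter> space \<nu>) = 0"
    using T by (auto simp: null_sets_def emeasure_distr)
  then have "T -` A \<inter> space \<nu> \<in> null_sets \<mu>"
    using ac measurable_sets[OF T A] by (auto simp: absolutely_continuous_def null_sets_def)
  moreover have "T \<in> measurable \<mu> S" using T sets by (simp cong: measurable_cong_sets)
  moreover have "space \<mu> = space \<nu>" using sets by (rule sets_eq_imp_space_eq)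
  ultimately show "A \<in> null_sets (distr \<mu> S T)"
    using A by (auto simp: null_sets_def emeasure_distr)
qed

text \<open>
  Data processing inequality: the test functions on the image space are, after composition with
  \<open>T\<close>, among those on the source space.
\<close>

lemma rel_entropy_distr_le:
  fixes \<mu> \<nu> :: "'a measure"
  assumes \<nu>: "prob_space \<nu>" and \<mu>: "prob_space \<mu>"
    and sets: "sets \<mu> = sets \<nu>" and ac: "absolutely_continuous \<nu> \<mu>"
    and C: "rel_entropy \<mu> \<nu> \<le> ereal C" and T: "T \<in> measurable \<nu> S"
  shows "rel_entropy (distr \<mu> S T) (distr \<nu> S T) \<le> ereal C"
proof (rule variational_upper_bound)
  have T': "T \<in> measurable \<mu> S" using T sets by (simp cong: measurable_cong_sets)
  show "prob_space (distr \<nu> S T)" "prob_space (distr \<mu> S T)"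
    using \<nu> \<mu> T T' by (auto intro: prob_space.prob_space_distr)
  show "absolutely_continuous (distr \<nu> S T) (distr \<mu> S T)"
    by (rule absolutely_continuous_distr[OF T sets ac])
  fix \<phi> :: "'b \<Rightarrow> real" and B
  assume \<phi>: "\<phi> \<in> borel_measurable (distr \<nu> S T)" and bd: "\<And>x. \<bar>\<phi> x\<bar> \<le> B"
  then have \<phi>S: "\<phi> \<in> borel_measurable S" by simp
  have "(\<integral>x. \<phi> x \<partial>distr \<mu> S T) = (\<integral>x. \<phi> (T x) \<partial>\<mu>)" by (rule integral_distr[OF T' \<phi>S])
  also have "\<dots> \<le> C + (\<integral>x. exp (\<phi> (T x)) \<partial>\<nu>) - 1"
    using bd by (intro variational_lower_bound[OF \<nu> \<mu> sets ac C measurable_compose[OF T \<phi>S]])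
  also have "(\<integral>x. exp (\<phi> (T x)) \<partial>\<nu>) = (\<integral>x. exp (\<phi> x) \<partial>distr \<nu> S T)"
    using \<phi>S by (intro integral_distr[OF T, symmetric]) measurable
  finally show "(\<integral>x. \<phi> x \<partial>distr \<mu> S T) \<le> C + (\<integral>x. exp (\<phi> x) \<partial>distr \<nu> S T) - 1" .
qed simp

lemma PiM_density:
  fixes f :: "'b \<Rightarrow> ennreal"
  assumes I: "finite I" and M: "sigma_finite_measure M"
    and f[measurable]: "f \<in> borel_measurable M" and Mf: "sigma_finite_measure (density M f)"
  shows "PiM I (\<lambda>_. density M f) = density (PiM I (\<lambda>_. M)) (\<lambda>x. \<Prod>i\<in>I. f (x i))"
proof -
  interpret D: product_sigma_finite "\<lambda>_. density M f" by (simp add: product_sigma_finite_def Mf)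
  interpret M: product_sigma_finite "\<lambda>_. M" by (simp add: product_sigma_finite_def M)
  show ?thesis
  proof (rule D.PiM_eqI[OF I, symmetric])
    show "sets (density (PiM I (\<lambda>_. M)) (\<lambda>x. \<Prod>i\<in>I. f (x i))) = sets (PiM I (\<lambda>_. density M f))"
      by (simp cong: sets_PiM_cong)
    fix A assume A: "\<And>i. i \<in> I \<Longrightarrow> A i \<in> sets (density M f)"
    then have A'[measurable]: "\<And>i. i \<in> I \<Longrightarrow> A i \<in> sets M" by simp
    have "Pi\<^sub>E I A \<in> sets (PiM I (\<lambda>_. M))" using I A' by (intro sets_PiM_I_finite)
    then have "emeasure (density (PiM I (\<lambda>_. M)) (\<lambda>x. \<Prod>i\<in>I. f (x i))) (Pi\<^sub>E I A)
      = (\<integral>\<^sup>+x. (\<Prod>i\<in>I. f (x i)) * indicator (Pi\<^sub>E I A) x \<partial>PiM I (\<lambda>_. M))"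
      by (intro emeasure_density) simp_all
    also have "\<dots> = (\<integral>\<^sup>+x. (\<Prod>i\<in>I. f (x i) * indicator (A i) (x i)) \<partial>PiM I (\<lambda>_. M))"
    proof (rule nn_integral_cong)
      fix x assume "x \<in> space (PiM I (\<lambda>_. M))"
      then have "indicator (Pi\<^sub>E I A) x = (\<Prod>i\<in>I. indicator (A i) (x i) :: ennreal)"
        using I by (auto simp: indicator_def PiE_iff space_PiM prod_zero_iff)
      then show "(\<Prod>i\<in>I. f (x i)) * indicator (Pi\<^sub>E I A) x = (\<Prod>i\<in>I. f (x i) * indicator (A i) (x i))"
        by (simp add: prod.distrib)
    qed
    also have "\<dots> = (\<Prod>i\<in>I. \<integral>\<^sup>+x. f x * indicator (A i) x \<partial>M)"
      using I by (intro M.product_nn_integral_prod) measurable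
    also have "\<dots> = (\<Prod>i\<in>I. emeasure (density M f) (A i))"
      by (intro prod.cong refl) (simp add: emeasure_density)
    finally show "emeasure (density (PiM I (\<lambda>_. M)) (\<lambda>x. \<Prod>i\<in>I. f (x i))) (Pi\<^sub>E I A)
      = (\<Prod>i\<in>I. emeasure (density M f) (A i))" .
  qed
qed

text \<open>
  Each term on the right is again a product of functions of single factors and therefore
  integrates factor by factor over a product space. The case of a vanishing factor is covered
  because \<open>0 ln 0 = 0\<close>.
\<close>

lemma prod_mult_ln_prod:
  fixes a :: "'i \<Rightarrow> real"
  assumes I: "finite I" and a: "\<And>i. 0 \<le> a i"
  shows "prod a I * ln (prod a I) = (\<Sum>i\<in>I. \<Prod>j\<in>I. if j = i then a j * ln (a j) else a j)"
proof -
  have split: "(\<Prod>j\<in>I. if j = i then a j * ln (a j) else a j) = prod a I * ln (a i)" if i: "i \<in> I" for i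
  proof -
    have "(\<Prod>j\<in>I. if j = i then a j * ln (a j) else a j) = a i * ln (a i) * (\<Prod>j\<in>I - {i}. a j)"
      using I i by (subst prod.remove[of _ i]) (auto intro!: prod.cong)
    also have "\<dots> = prod a I * ln (a i)" using I i by (simp add: prod.remove[of I i a])
    finally show ?thesis .
  qed
  show ?thesis
  proof (cases "\<exists>i\<in>I. a i = 0")
    case True
    then have "prod a I = 0" using I by (simp add: prod_zero_iff)
    then show ?thesis by (simp add: split)
  next
    case False
    then have "a i \<noteq> 0" if "i \<in> I" for i using that by blast
    then have "ln (prod a I) = (\<Sum>i\<in>I. ln (a i))" using I by (intro ln_prod) auto
    then show ?thesis by (simp add: split sum_distrib_left)
  qed
qed

text \<open>
  Entropy is at most additive on products: with the product density \<open>F\<close>, the integral of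
  \<open>F ln F\<close> is computed coordinate by coordinate and Young's inequality is integrated once more.
\<close>

lemma
  fixes \<mu> \<nu> :: "'a measure"
  assumes I: "finite I" and \<nu>: "prob_space \<nu>" and \<mu>: "prob_space \<mu>"
    and sets: "sets \<mu> = sets \<nu>" and ac: "absolutely_continuous \<nu> \<mu>"
  shows absolutely_continuous_PiM: "absolutely_continuous (PiM I (\<lambda>_. \<nu>)) (PiM I (\<lambda>_. \<mu>))"
    and rel_entropy_PiM_le: "rel_entropy \<mu> \<nu> \<le> ereal C \<Longrightarrow>
      rel_entropy (PiM I (\<lambda>_. \<mu>)) (PiM I (\<lambda>_. \<nu>)) \<le> ereal (real (card I) * C)"
proof -
  interpret \<nu>: prob_space \<nu> by fact
  interpret \<mu>: prob_space \<mu> by fact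
  interpret product_sigma_finite "\<lambda>_. \<nu>" by standard
  let ?P = "PiM I (\<lambda>_. \<nu>)" and ?Q = "PiM I (\<lambda>_. \<mu>)"
  have P: "prob_space ?P" and Q: "prob_space ?Q" by (intro prob_space_PiM \<nu> \<mu>)+
  interpret P: prob_space ?P by fact
  have sPQ: "sets ?Q = sets ?P" using sets by (intro sets_PiM_cong) auto
  have dens: "?Q = density ?P (\<lambda>x. \<Prod>i\<in>I. h (x i))"
    if "\<mu> = density \<nu> h" "h \<in> borel_measurable \<nu>" for h
    using PiM_density[OF I \<nu>.sigma_finite_measure_axioms that(2)] \<mu>.sigma_finite_measure_axioms
    by (simp add: that(1)[symmetric])
  show acP: "absolutely_continuous ?P ?Q"
    unfolding dens[OF \<nu>.density_RN_deriv[OF ac sets, symmetric] borel_measurable_RN_deriv]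
    by (rule absolutely_continuousI_density) measurable
  assume C: "rel_entropy \<mu> \<nu> \<le> ereal C"
  obtain h where h[measurable]: "h \<in> borel_measurable \<nu>" and h0': "\<forall>x. 0 \<le> h x"
    and d: "\<mu> = density \<nu> (\<lambda>x. ennreal (h x))"
    and ih: "integrable \<nu> h" and h1: "(\<integral>x. h x \<partial>\<nu>) = 1"
    and il: "integrable \<nu> (\<lambda>x. h x * ln (h x))" and lC: "(\<integral>x. h x * ln (h x) \<partial>\<nu>) \<le> C"
    by (rule finite_rel_entropy_density[OF \<nu> \<mu> sets ac C])
  have h0: "0 \<le> h x" for x using h0' by blast
  define F where "F x = (\<Prod>i\<in>I. h (x i))" for x
  define f where "f i j = (if j = i then (\<lambda>v. h v * ln (h v)) else h)" for i j :: 'b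
  have F0: "0 \<le> F x" for x unfolding F_def by (intro prod_nonneg) (simp add: h0)
  have [measurable]: "F \<in> borel_measurable ?P" unfolding F_def by measurable
  have QF: "?Q = density ?P (\<lambda>x. ennreal (F x))"
    using dens[OF d] by (simp add: F_def prod_ennreal h0)
  have FlnF: "F x * ln (F x) = (\<Sum>i\<in>I. \<Prod>j\<in>I. f i j (x j))" for x
    unfolding F_def prod_mult_ln_prod[OF I h0] by (intro sum.cong prod.cong refl) (auto simp: f_def)
  have fi: "integrable \<nu> (f i j)" for i j using ih il by (simp add: f_def)
  have iF: "integrable ?P F" unfolding F_def by (intro product_integrable_prod I ih)
  have F1: "(\<integral>x. F x \<partial>?P) = 1" unfolding F_def using product_integral_prod[OF I, of "\<lambda>_. h"] ih h1 by simp
  have iFl: "integrable ?P (\<lambda>x. F x * ln (F x))"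
    unfolding FlnF by (intro Bochner_Integration.integrable_sum product_integrable_prod I fi)
  have "(\<integral>x. F x * ln (F x) \<partial>?P) = (\<Sum>i\<in>I. \<integral>x. (\<Prod>j\<in>I. f i j (x j)) \<partial>?P)"
    unfolding FlnF by (intro Bochner_Integration.integral_sum product_integrable_prod I fi)
  also have "\<dots> = (\<Sum>i\<in>I. \<Prod>j\<in>I. integral\<^sup>L \<nu> (f i j))"
    by (intro sum.cong refl product_integral_prod I fi)
  also have "\<dots> = (\<Sum>i\<in>I. \<integral>x. h x * ln (h x) \<partial>\<nu>)"
  proof (intro sum.cong refl)
    fix i assume i: "i \<in> I"
    have "(\<Prod>j\<in>I. integral\<^sup>L \<nu> (f i j)) = (\<Prod>j\<in>I. if j = i then \<integral>x. h x * ln (h x) \<partial>\<nu> else 1)"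
      by (intro prod.cong refl) (auto simp: f_def h1)
    then show "(\<Prod>j\<in>I. integral\<^sup>L \<nu> (f i j)) = (\<integral>x. h x * ln (h x) \<partial>\<nu>)" using I i by simp
  qed
  finally have FC: "(\<integral>x. F x * ln (F x) \<partial>?P) \<le> real (card I) * C"
    using lC by (simp add: mult_left_mono)
  show "rel_entropy ?Q ?P \<le> ereal (real (card I) * C)"
  proof (rule variational_upper_bound[OF P Q sPQ acP])
    fix \<phi> :: "('b \<Rightarrow> 'a) \<Rightarrow> real" and B
    assume \<phi>[measurable]: "\<phi> \<in> borel_measurable ?P" and bd: "\<And>x. \<bar>\<phi> x\<bar> \<le> B"
    have inte: "integrable ?P (\<lambda>x. exp (\<phi> x))"
      by (rule P.exp_bounded_integral[OF \<phi> bd])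
    have iF\<phi>: "integrable ?P (\<lambda>x. F x * \<phi> x)"
    proof (rule Bochner_Integration.integrable_bound[OF integrable_mult_right[OF iF, of B]])
      have "\<bar>F x * \<phi> x\<bar> \<le> \<bar>B * F x\<bar>" for x
        using mult_left_mono[OF order_trans[OF bd abs_ge_self, of x] F0[of x]] F0[of x]
        by (simp add: abs_mult mult.commute)
      then show "AE x in ?P. norm (F x * \<phi> x) \<le> norm (B * F x)" by simp
    qed measurable
    have "(\<integral>x. \<phi> x \<partial>?Q) = (\<integral>x. F x * \<phi> x \<partial>?P)"
      unfolding QF using F0 by (subst integral_density) auto
    also have "\<dots> \<le> (\<integral>x. F x * ln (F x) - F x + exp (\<phi> x) \<partial>?P)"
      using iF\<phi> iF iFl inte F0 by (intro integral_mono entropy_young) auto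
    also have "\<dots> = (\<integral>x. F x * ln (F x) \<partial>?P) - 1 + (\<integral>x. exp (\<phi> x) \<partial>?P)"
      using iF iFl inte F1 by simp
    finally show "(\<integral>x. \<phi> x \<partial>?Q) \<le> real (card I) * C + (\<integral>x. exp (\<phi> x) \<partial>?P) - 1"
      using FC by simp
  qed
qed


section \<open>The uniform measure on the sphere in polar coordinates\<close>

abbreviation lebesgue_prod :: "nat \<Rightarrow> (nat \<Rightarrow> real) measure" where
  "lebesgue_prod N \<equiv> PiM {..<N} (\<lambda>_. lborel)"

text \<open>
  Homogeneity of Lebesgue measure is the only geometric input to the polar decomposition below.
\<close>

lemma lebesgue_prod_scale:
  fixes c :: real
  assumes c: "0 < c" and S[measurable]: "S \<in> sets (lebesgue_prod N)"
  shows "emeasure (lebesgue_prod N) S = ennreal (c ^ N) *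
    emeasure (lebesgue_prod N) {x \<in> space (lebesgue_prod N). (\<lambda>i\<in>{..<N}. c * x i) \<in> S}"
proof -
  interpret product_sigma_finite "\<lambda>_::nat. lborel :: real measure" by standard
  let ?L = "lebesgue_prod N" and ?s = "\<lambda>x. \<lambda>i\<in>{..<N}. c * x i"
  have sm[measurable]: "?s \<in> measurable ?L ?L" by measurable
  have "scale_measure (ennreal (c ^ N)) (distr ?L ?L ?s) = ?L"
  proof (rule PiM_eqI)
    fix A :: "nat \<Rightarrow> real set" assume A: "\<And>i. i \<in> {..<N} \<Longrightarrow> A i \<in> sets lborel"
    have P: "Pi\<^sub>E {..<N} A \<in> sets ?L" using A by (intro sets_PiM_I_finite) auto
    have "emeasure (scale_measure (ennreal (c ^ N)) (distr ?L ?L ?s)) (Pi\<^sub>E {..<N} A)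
      = ennreal (c ^ N) * emeasure ?L (?s -` Pi\<^sub>E {..<N} A \<inter> space ?L)"
      using P by (simp add: emeasure_distr)
    also have "?s -` Pi\<^sub>E {..<N} A \<inter> space ?L = Pi\<^sub>E {..<N} (\<lambda>i. (*) c -` A i)"
      by (auto simp: space_PiM PiE_iff)
    also have "emeasure ?L \<dots> = (\<Prod>i<N. emeasure lborel ((*) c -` A i))"
    proof (rule emeasure_PiM)
      fix i assume "i \<in> {..<N}"
      then show "(*) c -` A i \<in> sets lborel"
        using measurable_sets[of "(*) c" borel borel "A i"] A by simp
    qed simp
    also have "\<dots> = (\<Prod>i<N. ennreal (inverse c) * emeasure lborel (A i))"
    proof (intro prod.cong refl)
      fix i assume i: "i \<in> {..<N}"
      then have "emeasure lborel ((*) c -` A i) = emeasure (distr lborel borel ((*) c)) (A i)"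
        using A by (subst emeasure_distr) auto
      also have "\<dots> = ennreal (inverse c) * emeasure lborel (A i)"
        using c i A by (subst lborel_distr_mult) (auto simp: emeasure_density_const)
      finally show "emeasure lborel ((*) c -` A i) = ennreal (inverse c) * emeasure lborel (A i)" .
    qed
    also have "ennreal (c ^ N) * \<dots> = (\<Prod>i<N. emeasure lborel (A i))"
      using c by (simp add: prod.distrib mult.assoc[symmetric] ennreal_power
          ennreal_mult'[symmetric] power_mult_distrib[symmetric])
    finally show "emeasure (scale_measure (ennreal (c ^ N)) (distr ?L ?L ?s)) (Pi\<^sub>E {..<N} A)
      = (\<Prod>i<N. emeasure lborel (A i))" .
  qed simp_all
  then have "emeasure ?L S = emeasure (scale_measure (ennreal (c ^ N)) (distr ?L ?L ?s)) S" by simp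
  also have "\<dots> = ennreal (c ^ N) * emeasure ?L (?s -` S \<inter> space ?L)"
    by (simp add: emeasure_distr)
  also have "?s -` S \<inter> space ?L = {x \<in> space ?L. ?s x \<in> S}" by auto
  finally show ?thesis .
qed

lemma sqnorm_nonneg: "0 \<le> sqnorm N x"
  by (simp add: sqnorm_def sum_nonneg)

lemma sqnorm_scale: "sqnorm N (\<lambda>i\<in>{..<N}. c * x i) = c\<^sup>2 * sqnorm N x"
  by (simp add: sqnorm_def power_mult_distrib sum_distrib_left)

lemma radial_proj_scale:
  assumes "0 < c"
  shows "radial_proj N (\<lambda>i\<in>{..<N}. c * x i) = radial_proj N x"
  using assms by (auto simp: radial_proj_def sqnorm_scale real_sqrt_mult fun_eq_iff)

lemma sqnorm_borel_measurable[measurable]: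
  assumes "\<And>i. i < N \<Longrightarrow> sets (M i) = sets borel"
  shows "sqnorm N \<in> borel_measurable (PiM {..<N} M)"
proof -
  have "sets (PiM {..<N} M) = sets (lebesgue_prod N)"
    using assms by (intro sets_PiM_cong) auto
  with sqnorm_measurable[of N] show ?thesis by (simp cong: measurable_cong_sets)
qed

lemma radial_proj_PiM_measurable:
  assumes "\<And>i. i < N \<Longrightarrow> sets (M i) = sets borel"
  shows "radial_proj N \<in> measurable (PiM {..<N} M) (sphere_space N)"
proof -
  have "sets (PiM {..<N} M) = sets (lebesgue_ball N)"
    using assms by (auto simp: lebesgue_ball_def intro!: sets_PiM_cong)
  with radial_proj_measurable[of N] show ?thesis by (simp cong: measurable_cong_sets)
qed

lemma radial_proj_lebesgue_measurable[measurable]: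
  "radial_proj N \<in> measurable (lebesgue_prod N) (sphere_space N)"
  by (rule radial_proj_PiM_measurable) simp

lemma emeasure_unif_sphere:
  assumes A[measurable]: "A \<in> sets (sphere_space N)"
  shows "emeasure (unif_sphere N) A =
    emeasure (lebesgue_prod N) {x \<in> space (lebesgue_prod N). radial_proj N x \<in> A \<and> sqnorm N x \<le> real N}
    / emeasure (lebesgue_prod N) {x \<in> space (lebesgue_prod N). sqnorm N x \<le> real N}"
proof -
  let ?L = "lebesgue_prod N"
  note sqnorm_measurable[measurable]
  have "emeasure (unif_sphere N) A = emeasure (lebesgue_ball N) (radial_proj N -` A \<inter> space ?L)"
    unfolding unif_sphere_def
    by (subst emeasure_distr[OF radial_proj_measurable]) (auto simp: lebesgue_ball_def)
  also have "radial_proj N -` A \<inter> space ?L = {x \<in> space ?L. radial_proj N x \<in> A}" by auto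
  also have "emeasure (lebesgue_ball N) \<dots> =
     emeasure ?L ({x \<in> space ?L. sqnorm N x \<le> real N} \<inter> {x \<in> space ?L. radial_proj N x \<in> A})
    / emeasure ?L {x \<in> space ?L. sqnorm N x \<le> real N}"
    unfolding lebesgue_ball_def by (rule emeasure_uniform_measure) measurable
  also have "{x \<in> space ?L. sqnorm N x \<le> real N} \<inter> {x \<in> space ?L. radial_proj N x \<in> A}
     = {x \<in> space ?L. radial_proj N x \<in> A \<and> sqnorm N x \<le> real N}" by auto
  finally show ?thesis .
qed

lemma lebesgue_ball_nontrivial:
  fixes N defines "B \<equiv> {x \<in> space (lebesgue_prod N). sqnorm N x \<le> real N}"
  shows "emeasure (lebesgue_prod N) B \<noteq> 0" "emeasure (lebesgue_prod N) B \<noteq> \<infinity>"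
proof -
  interpret prob_space "lebesgue_ball N" by (rule prob_space_lebesgue_ball)
  note sqnorm_measurable[measurable]
  have B[measurable]: "B \<in> sets (lebesgue_prod N)" unfolding B_def by measurable
  have "1 = emeasure (lebesgue_ball N) (space (lebesgue_prod N))"
    using emeasure_space_1 by (simp add: lebesgue_ball_def)
  also have "\<dots> = emeasure (lebesgue_prod N) (B \<inter> space (lebesgue_prod N)) / emeasure (lebesgue_prod N) B"
    unfolding lebesgue_ball_def B_def[symmetric] by (rule emeasure_uniform_measure) simp_all
  also have "B \<inter> space (lebesgue_prod N) = B" by (auto simp: B_def)
  finally have *: "1 = emeasure (lebesgue_prod N) B / emeasure (lebesgue_prod N) B" .
  show "emeasure (lebesgue_prod N) B \<noteq> 0" using * by (intro notI) simp
  show "emeasure (lebesgue_prod N) B \<noteq> \<infinity>" using * by (intro notI) simp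
qed

lemma emeasure_cone_ball:
  assumes N: "0 < N" and A[measurable]: "A \<in> sets (sphere_space N)" and s: "0 < s"
  shows "emeasure (lebesgue_prod N) {x \<in> space (lebesgue_prod N). radial_proj N x \<in> A \<and> sqnorm N x \<le> s}
    = ennreal (sqrt (s / N) ^ N) *
      emeasure (lebesgue_prod N) {x \<in> space (lebesgue_prod N). radial_proj N x \<in> A \<and> sqnorm N x \<le> real N}"
proof -
  let ?L = "lebesgue_prod N"
  note sqnorm_measurable[measurable]
  define c where "c = sqrt (s / N)"
  have c: "0 < c" and c2: "c\<^sup>2 = s / N" using N s by (auto simp: c_def)
  have le: "c\<^sup>2 * r \<le> s \<longleftrightarrow> r \<le> real N" for r
    using N s by (simp add: c2 field_simps)
  have [simp]: "(\<lambda>i\<in>{..<N}. c * x i) \<in> space ?L" for x by (simp add: space_PiM)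
  have "{x \<in> space ?L. (\<lambda>i\<in>{..<N}. c * x i) \<in> {x \<in> space ?L. radial_proj N x \<in> A \<and> sqnorm N x \<le> s}}
    = {x \<in> space ?L. radial_proj N x \<in> A \<and> sqnorm N x \<le> real N}"
    using c by (simp add: radial_proj_scale sqnorm_scale le)
  then show ?thesis
    using lebesgue_prod_scale[OF c, of "{x \<in> space ?L. radial_proj N x \<in> A \<and> sqnorm N x \<le> s}" N]
    by (simp add: c_def)
qed

lemma radial_proj_in_space: "radial_proj N x \<in> space (sphere_space N)"
proof -
  have "(\<lambda>i\<in>{..<N}. x i) \<in> space (lebesgue_prod N)" by (simp add: space_PiM)
  then have "radial_proj N (\<lambda>i\<in>{..<N}. x i) \<in> space (sphere_space N)"
    by (rule measurable_space[OF radial_proj_lebesgue_measurable])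
  moreover have "radial_proj N (\<lambda>i\<in>{..<N}. x i) = radial_proj N x"
    by (auto simp: radial_proj_def sqnorm_def fun_eq_iff)
  ultimately show ?thesis by simp
qed

text \<open>
  Cones are invariant under dilations, so the share that a cone takes of a ball does not depend
  on the radius of the ball; for the radius \<open>sqrt N\<close> that share is the cone measure by definition.
\<close>

lemma emeasure_cone_ball_factor:
  assumes N: "0 < N" and A[measurable]: "A \<in> sets (sphere_space N)"
  shows "emeasure (lebesgue_prod N) {x \<in> space (lebesgue_prod N). radial_proj N x \<in> A \<and> sqnorm N x \<le> s}
    = emeasure (unif_sphere N) A * emeasure (lebesgue_prod N) {x \<in> space (lebesgue_prod N). sqnorm N x \<le> s}"
proof (cases "0 < s")
  case True
  let ?L = "lebesgue_prod N"
  let ?C = "emeasure ?L {x \<in> space ?L. radial_proj N x \<in> A \<and> sqnorm N x \<le> real N}"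
  let ?B = "emeasure ?L {x \<in> space ?L. sqnorm N x \<le> real N}"
  have "emeasure ?L {x \<in> space ?L. sqnorm N x \<le> s} = ennreal (sqrt (s / N) ^ N) * ?B"
    using emeasure_cone_ball[OF N sets.top True] by (simp add: radial_proj_in_space)
  moreover have "emeasure ?L {x \<in> space ?L. radial_proj N x \<in> A \<and> sqnorm N x \<le> s}
      = ennreal (sqrt (s / N) ^ N) * ?C"
    by (rule emeasure_cone_ball[OF N A True])
  moreover have "?C = emeasure (unif_sphere N) A * ?B"
    using lebesgue_ball_nontrivial[of N]
    by (subst emeasure_unif_sphere[OF A]) (simp add: ennreal_divide_times ennreal_mult_divide_eq less_top)
  ultimately show ?thesis by (simp add: ac_simps)
next
  case False
  interpret product_sigma_finite "\<lambda>_::nat. lborel :: real measure" by standard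
  \<comment> \<open>For \<open>s \<le> 0\<close> both sides vanish: the ball is contained in the origin, a null set.\<close>
  have sub: "{x \<in> space (lebesgue_prod N). sqnorm N x \<le> s} \<subseteq> Pi\<^sub>E {..<N} (\<lambda>_. {0})"
  proof
    fix x assume "x \<in> {x \<in> space (lebesgue_prod N). sqnorm N x \<le> s}"
    then have x: "x \<in> space (lebesgue_prod N)" and le: "sqnorm N x \<le> s" by auto
    then have "sqnorm N x = 0" using False sqnorm_nonneg[of N x] by linarith
    then have "\<forall>i<N. x i = 0" by (auto simp: sqnorm_def sum_nonneg_eq_0_iff)
    with x show "x \<in> Pi\<^sub>E {..<N} (\<lambda>_. {0})" by (intro PiE_I) (auto simp: space_PiM PiE_iff extensional_def)
  qed
  have zero: "emeasure (lebesgue_prod N) (Pi\<^sub>E {..<N} (\<lambda>_. {0})) = 0"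
    using N by (subst emeasure_PiM) auto
  have meas: "Pi\<^sub>E {..<N} (\<lambda>_. {0}) \<in> sets (lebesgue_prod N)"
    by (intro sets_PiM_I_finite) auto
  have *: "emeasure (lebesgue_prod N) S = 0" if "S \<subseteq> Pi\<^sub>E {..<N} (\<lambda>_. {0})" for S
    using emeasure_mono[OF that meas] unfolding zero by (simp only: le_zero_eq)
  show ?thesis using *[OF sub] *[of "{x \<in> space (lebesgue_prod N). radial_proj N x \<in> A \<and> sqnorm N x \<le> s}"] sub
    by auto
qed

text \<open>
  The image of Lebesgue measure on the cone over \<open>A\<close> under \<open>sqnorm N\<close> and the corresponding
  image of the full Lebesgue measure, scaled by the cone measure of \<open>A\<close>, agree on all half-lines
  \<open>{..s}\<close>, hence they are equal.
\<close>

lemma polar_coordinates: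
  assumes N: "0 < N" and A[measurable]: "A \<in> sets (sphere_space N)"
    and g[measurable]: "g \<in> borel_measurable borel"
  shows "(\<integral>\<^sup>+x. g (sqnorm N x) * indicator A (radial_proj N x) \<partial>lebesgue_prod N)
    = emeasure (unif_sphere N) A * (\<integral>\<^sup>+x. g (sqnorm N x) \<partial>lebesgue_prod N)"
proof -
  let ?L = "lebesgue_prod N"
  note sqnorm_measurable[measurable]
  have [measurable]: "(\<lambda>x. indicator A (radial_proj N x) :: ennreal) \<in> borel_measurable ?L"
    by measurable
  define D where "D = density ?L (\<lambda>x. indicator A (radial_proj N x))"
  define r where "r = emeasure (unif_sphere N) A"
  interpret S: prob_space "unif_sphere N" by (rule prob_space_unif_sphere)
  have r: "r < \<infinity>" by (simp add: r_def S.emeasure_eq_measure)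
  have [measurable]: "sqnorm N \<in> borel_measurable D" by (simp add: D_def)
  have le: "emeasure (distr D borel (sqnorm N)) {..s} = r * emeasure ?L {x \<in> space ?L. sqnorm N x \<le> s}" for s
  proof -
    have "emeasure (distr D borel (sqnorm N)) {..s} = emeasure D {x \<in> space ?L. sqnorm N x \<le> s}"
      by (subst emeasure_distr) (auto simp: D_def intro!: arg_cong2[where f=emeasure])
    also have "\<dots> = (\<integral>\<^sup>+x. indicator A (radial_proj N x) * indicator {x \<in> space ?L. sqnorm N x \<le> s} x \<partial>?L)"
      unfolding D_def by (rule emeasure_density) measurable
    also have "\<dots> = (\<integral>\<^sup>+x. indicator {x \<in> space ?L. radial_proj N x \<in> A \<and> sqnorm N x \<le> s} x \<partial>?L)"
      by (intro nn_integral_cong) (auto simp: indicator_def)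
    also have "\<dots> = emeasure ?L {x \<in> space ?L. radial_proj N x \<in> A \<and> sqnorm N x \<le> s}"
      by (rule nn_integral_indicator) measurable
    finally show ?thesis by (simp add: emeasure_cone_ball_factor[OF N A] r_def)
  qed
  have "distr D borel (sqnorm N) = scale_measure r (distr ?L borel (sqnorm N))"
  proof (rule measure_eqI_generator_eq[where E="range atMost" and \<Omega>=UNIV and A="\<lambda>n. {..real n}"])
    show "Int_stable (range (atMost :: real \<Rightarrow> real set))"
      by (auto simp: Int_stable_def)
    show "emeasure (distr D borel (sqnorm N)) X = emeasure (scale_measure r (distr ?L borel (sqnorm N))) X"
      if "X \<in> range atMost" for X
    proof -
      from that obtain s where X: "X = {..s}" by auto
      have "emeasure (distr ?L borel (sqnorm N)) {..s} = emeasure ?L {x \<in> space ?L. sqnorm N x \<le> s}"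
        by (subst emeasure_distr) (auto intro!: arg_cong2[where f=emeasure])
      then show ?thesis by (simp add: X le)
    qed
    show "emeasure (distr D borel (sqnorm N)) {..real n} \<noteq> \<infinity>" for n
    proof -
      have "emeasure ?L {x \<in> space ?L. sqnorm N x \<le> real n} \<le> emeasure ?L {x \<in> space ?L. sqnorm N x \<le> real (Suc n)}"
        by (intro emeasure_mono) auto
      also have "\<dots> = ennreal (sqrt (real (Suc n) / N) ^ N) * emeasure ?L {x \<in> space ?L. sqnorm N x \<le> real N}"
        using emeasure_cone_ball[OF N sets.top, of "real (Suc n)"] by (simp add: radial_proj_in_space)
      also have "\<dots> < \<infinity>"
        using lebesgue_ball_nontrivial(2)[of N] by (simp add: ennreal_mult_less_top less_top)
      finally show ?thesis unfolding le using r by (auto simp: ennreal_mult_eq_top_iff less_top)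
    qed
    show "(\<Union>n. {..real n}) = UNIV" using real_arch_simple by auto
    show "sets (distr D borel (sqnorm N)) = sigma_sets UNIV (range atMost)"
      by (simp add: borel_eq_atMost)
    show "sets (scale_measure r (distr ?L borel (sqnorm N))) = sigma_sets UNIV (range atMost)"
      by (simp add: borel_eq_atMost)
  qed auto
  then have "(\<integral>\<^sup>+y. g y \<partial>distr D borel (sqnorm N)) = r * (\<integral>\<^sup>+y. g y \<partial>distr ?L borel (sqnorm N))"
    by (simp add: nn_integral_scale_measure)
  then show ?thesis
    by (simp add: nn_integral_distr D_def nn_integral_density r_def mult.commute)
qed

abbreviation gauss_prod :: "nat \<Rightarrow> (nat \<Rightarrow> real) measure" where
  "gauss_prod N \<equiv> PiM {..<N} (\<lambda>_. gauss_measure)"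

lemma prob_space_gauss_measure: "prob_space gauss_measure"
  unfolding gauss_measure_def using prob_space_normal_density[of 1 0] by simp

lemma sets_gauss_measure[simp]: "sets gauss_measure = sets borel"
  by (simp add: gauss_measure_def)

lemma sets_gauss_prod: "sets (gauss_prod N) = sets (lebesgue_prod N)"
  by (rule sets_PiM_cong) simp_all

text \<open>
  The Gaussian product density depends on the radius alone, which makes direction and radius
  independent under it.
\<close>

lemma gauss_prod_radial:
  "gauss_prod N = density (lebesgue_prod N) (\<lambda>x. ennreal ((1 / sqrt (2 * pi)) ^ N * exp (- sqnorm N x / 2)))"
proof -
  have "sigma_finite_measure gauss_measure"
    using prob_space_gauss_measure by (simp add: prob_space_imp_sigma_finite)
  then have "gauss_prod N = density (lebesgue_prod N) (\<lambda>x. \<Prod>i<N. ennreal (std_normal_density (x i)))"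
    unfolding gauss_measure_def by (intro PiM_density) (auto intro: lborel.sigma_finite_measure_axioms)
  also have "\<dots> = density (lebesgue_prod N) (\<lambda>x. ennreal ((1 / sqrt (2 * pi)) ^ N * exp (- sqnorm N x / 2)))"
  proof (rule arg_cong[where f="density (lebesgue_prod N)"], rule ext)
    fix x
    have "(\<Prod>i<N. ennreal (std_normal_density (x i))) = ennreal (\<Prod>i<N. 1 / sqrt (2 * pi) * exp (- (x i)\<^sup>2 / 2))"
      by (subst prod_ennreal) (auto simp: std_normal_density_def)
    also have "(\<Prod>i<N. 1 / sqrt (2 * pi) * exp (- (x i)\<^sup>2 / 2)) = (1 / sqrt (2 * pi)) ^ N * exp (\<Sum>i<N. - (x i)\<^sup>2 / 2)"
      unfolding prod.distrib by (simp add: exp_sum)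
    also have "(\<Sum>i<N. - (x i)\<^sup>2 / 2) = - sqnorm N x / 2"
      by (simp add: sqnorm_def sum_negf sum_divide_distrib)
    finally show "(\<Prod>i<N. ennreal (std_normal_density (x i)))
       = ennreal ((1 / sqrt (2 * pi)) ^ N * exp (- sqnorm N x / 2))" .
  qed
  finally show ?thesis .
qed

lemma gauss_direction_radius_indep:
  assumes N: "0 < N" and A[measurable]: "A \<in> sets (sphere_space N)" and T[measurable]: "T \<in> sets borel"
  shows "emeasure (gauss_prod N) {x \<in> space (gauss_prod N). radial_proj N x \<in> A \<and> sqnorm N x \<in> T}
    = emeasure (unif_sphere N) A * emeasure (gauss_prod N) {x \<in> space (gauss_prod N). sqnorm N x \<in> T}"
proof -
  let ?L = "lebesgue_prod N"
  note sqnorm_measurable[measurable]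
  define g where "g s = ennreal ((1 / sqrt (2 * pi)) ^ N * exp (- s / 2)) * indicator T s" for s
  have [measurable]: "g \<in> borel_measurable borel" unfolding g_def by measurable
  have *: "emeasure (gauss_prod N) {x \<in> space (gauss_prod N). radial_proj N x \<in> X \<and> sqnorm N x \<in> T}
    = emeasure (unif_sphere N) X * (\<integral>\<^sup>+x. g (sqnorm N x) \<partial>?L)" if X[measurable]: "X \<in> sets (sphere_space N)" for X
  proof -
    have "space (gauss_prod N) = space ?L" by (rule sets_eq_imp_space_eq[OF sets_gauss_prod])
    then have "emeasure (gauss_prod N) {x \<in> space (gauss_prod N). radial_proj N x \<in> X \<and> sqnorm N x \<in> T}
      = (\<integral>\<^sup>+x. ennreal ((1 / sqrt (2 * pi)) ^ N * exp (- sqnorm N x / 2))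
        * indicator {x \<in> space ?L. radial_proj N x \<in> X \<and> sqnorm N x \<in> T} x \<partial>?L)"
      by (subst gauss_prod_radial) (subst emeasure_density, auto)
    also have "\<dots> = (\<integral>\<^sup>+x. g (sqnorm N x) * indicator X (radial_proj N x) \<partial>?L)"
      by (intro nn_integral_cong) (auto simp: indicator_def g_def)
    finally show ?thesis by (simp add: polar_coordinates[OF N])
  qed
  interpret S: prob_space "unif_sphere N" by (rule prob_space_unif_sphere)
  have "space (sphere_space N) = space (unif_sphere N)" by (rule sets_eq_imp_space_eq[OF sets_unif_sphere, symmetric])
  then have "emeasure (unif_sphere N) (space (sphere_space N)) = 1" using S.emeasure_space_1 by simp
  then have "emeasure (gauss_prod N) {x \<in> space (gauss_prod N). sqnorm N x \<in> T} = (\<integral>\<^sup>+x. g (sqnorm N x) \<partial>?L)"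
    using *[OF sets.top] by (simp add: radial_proj_in_space)
  with *[OF A] show ?thesis by simp
qed

lemma radial_proj_gauss_measurable[measurable]:
  "radial_proj N \<in> measurable (gauss_prod N) (sphere_space N)"
  by (rule radial_proj_PiM_measurable) simp

lemma prob_space_gauss_prod: "prob_space (gauss_prod N)"
  by (intro prob_space_PiM prob_space_gauss_measure)

lemma radial_proj_gauss:
  assumes N: "0 < N"
  shows "distr (gauss_prod N) (sphere_space N) (radial_proj N) = unif_sphere N"
proof (rule measure_eqI)
  interpret prob_space "gauss_prod N" by (rule prob_space_gauss_prod)
  fix A assume "A \<in> sets (distr (gauss_prod N) (sphere_space N) (radial_proj N))"
  then have A: "A \<in> sets (sphere_space N)" by simp
  have "emeasure (distr (gauss_prod N) (sphere_space N) (radial_proj N)) A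
     = emeasure (gauss_prod N) {x \<in> space (gauss_prod N). radial_proj N x \<in> A \<and> sqnorm N x \<in> UNIV}"
    using A by (subst emeasure_distr) (auto intro!: arg_cong2[where f=emeasure])
  also have "\<dots> = emeasure (unif_sphere N) A"
    using gauss_direction_radius_indep[OF N A, of UNIV] emeasure_space_1 by simp
  finally show "emeasure (distr (gauss_prod N) (sphere_space N) (radial_proj N)) A = emeasure (unif_sphere N) A" .
qed (simp add: sets_unif_sphere)

text \<open>
  Expectations over the sphere are computed from Gaussian ones, even when the Gaussian is
  restricted to a thin shell around the sphere.
\<close>

lemma nn_integral_gauss_shell:
  assumes N: "0 < N" and T[measurable]: "T \<in> sets borel" and F[measurable]: "F \<in> borel_measurable (sphere_space N)"
  shows "(\<integral>\<^sup>+x. F (radial_proj N x) * indicator T (sqnorm N x) \<partial>gauss_prod N)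
    = emeasure (gauss_prod N) {x \<in> space (gauss_prod N). sqnorm N x \<in> T} * (\<integral>\<^sup>+x. F x \<partial>unif_sphere N)"
proof -
  let ?G = "gauss_prod N"
  have [measurable]: "sqnorm N \<in> borel_measurable ?G" by (rule sqnorm_borel_measurable) simp
  define D where "D = density ?G (\<lambda>x. indicator T (sqnorm N x))"
  have [measurable]: "radial_proj N \<in> measurable D (sphere_space N)" by (simp add: D_def)
  have F': "F \<in> borel_measurable (unif_sphere N)" using F sets_unif_sphere by (simp cong: measurable_cong_sets)
  have "distr D (sphere_space N) (radial_proj N)
    = scale_measure (emeasure ?G {x \<in> space ?G. sqnorm N x \<in> T}) (unif_sphere N)"
  proof (rule measure_eqI)
    fix A assume "A \<in> sets (distr D (sphere_space N) (radial_proj N))"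
    then have A[measurable]: "A \<in> sets (sphere_space N)" by simp
    have "emeasure (distr D (sphere_space N) (radial_proj N)) A = emeasure D {x \<in> space ?G. radial_proj N x \<in> A}"
      using A by (subst emeasure_distr) (auto intro!: arg_cong2[where f=emeasure] simp: D_def)
    also have "\<dots> = (\<integral>\<^sup>+x. indicator T (sqnorm N x) * indicator {x \<in> space ?G. radial_proj N x \<in> A} x \<partial>?G)"
      unfolding D_def by (rule emeasure_density) measurable
    also have "\<dots> = (\<integral>\<^sup>+x. indicator {x \<in> space ?G. radial_proj N x \<in> A \<and> sqnorm N x \<in> T} x \<partial>?G)"
      by (intro nn_integral_cong) (auto simp: indicator_def)
    also have "\<dots> = emeasure ?G {x \<in> space ?G. radial_proj N x \<in> A \<and> sqnorm N x \<in> T}"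
      by (rule nn_integral_indicator) measurable
    finally show "emeasure (distr D (sphere_space N) (radial_proj N)) A
      = emeasure (scale_measure (emeasure ?G {x \<in> space ?G. sqnorm N x \<in> T}) (unif_sphere N)) A"
      by (simp add: gauss_direction_radius_indep[OF N A T] mult.commute)
  qed (simp add: sets_unif_sphere)
  then have "(\<integral>\<^sup>+x. F x \<partial>distr D (sphere_space N) (radial_proj N))
    = emeasure ?G {x \<in> space ?G. sqnorm N x \<in> T} * (\<integral>\<^sup>+x. F x \<partial>unif_sphere N)"
    using F' by (simp add: nn_integral_scale_measure)
  then show ?thesis
    by (simp add: nn_integral_distr D_def nn_integral_density mult.commute)
qed

section \<open>Law of large numbers and chaos\<close>

lemma
  fixes h :: "'b \<Rightarrow> real"
  assumes M: "prob_space M" and i: "i \<in> I" and h[measurable]: "h \<in> borel_measurable M"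
  shows integral_PiM_component: "(\<integral>x. h (x i) \<partial>PiM I (\<lambda>_. M)) = (\<integral>v. h v \<partial>M)"
    and integrable_PiM_component: "integrable M h \<Longrightarrow> integrable (PiM I (\<lambda>_. M)) (\<lambda>x. h (x i))"
proof -
  have d: "distr (PiM I (\<lambda>_. M)) M (\<lambda>x. x i) = M"
    using distr_PiM_component[of I "\<lambda>_. M" i] M i by simp
  have m: "(\<lambda>x. x i) \<in> measurable (PiM I (\<lambda>_. M)) M" using i by simp
  show "(\<integral>x. h (x i) \<partial>PiM I (\<lambda>_. M)) = (\<integral>v. h v \<partial>M)"
    using integral_distr[OF m h] d by simp
  show "integrable M h \<Longrightarrow> integrable (PiM I (\<lambda>_. M)) (\<lambda>x. h (x i))"
    using integrable_distr_eq[OF m h] d by simp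
qed

text \<open>
  The off-diagonal terms of the squared sum vanish by independence.
\<close>

lemma second_moment_centred_sum:
  fixes w :: "'b \<Rightarrow> real"
  assumes M: "prob_space M" and w[measurable]: "w \<in> borel_measurable M"
    and bd: "\<And>v. \<bar>w v\<bar> \<le> B" and w0: "(\<integral>v. w v \<partial>M) = 0"
  shows "(\<integral>x. (\<Sum>i<N. w (x i))\<^sup>2 \<partial>PiM {..<N} (\<lambda>_. M)) = real N * (\<integral>v. (w v)\<^sup>2 \<partial>M)"
proof -
  interpret M: prob_space M by fact
  interpret product_sigma_finite "\<lambda>_::nat. M" by standard
  interpret P: prob_space "PiM {..<N} (\<lambda>_. M)" by (intro prob_space_PiM M)
  have iw: "integrable M w" using bd by (intro M.integrable_const_bound[of _ B]) auto
  have pair: "(\<integral>x. w (x i) * w (x j) \<partial>PiM {..<N} (\<lambda>_. M)) = (if i = j then \<integral>v. (w v)\<^sup>2 \<partial>M else 0)"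
    if i: "i < N" and j: "j < N" for i j
  proof (cases "i = j")
    case True
    then show ?thesis
      using i integral_PiM_component[OF M, of i "{..<N}" "\<lambda>v. (w v)\<^sup>2"] by (simp add: power2_eq_square)
  next
    case False
    define f where "f k = (if k \<in> {i, j} then w else (\<lambda>_. 1))" for k
    have "(\<Prod>k<N. f k (x k)) = w (x i) * w (x j)" for x
    proof -
      have "(\<Prod>k<N. f k (x k)) = (\<Prod>k\<in>{i, j}. f k (x k))"
        using i j by (intro prod.mono_neutral_right) (auto simp: f_def)
      also have "\<dots> = w (x i) * w (x j)" using False by (simp add: f_def)
      finally show ?thesis .
    qed
    then have "(\<integral>x. w (x i) * w (x j) \<partial>PiM {..<N} (\<lambda>_. M)) = (\<integral>x. (\<Prod>k<N. f k (x k)) \<partial>PiM {..<N} (\<lambda>_. M))"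
      by simp
    also have "\<dots> = (\<Prod>k<N. integral\<^sup>L M (f k))"
      using iw by (intro product_integral_prod) (auto simp: f_def)
    also have "\<dots> = 0"
      using i w0 by (intro prod_zero) (auto simp: f_def intro!: bexI[of _ i])
    finally show ?thesis using False by simp
  qed
  have int: "integrable (PiM {..<N} (\<lambda>_. M)) (\<lambda>x. w (x i) * w (x j))" if i: "i < N" and j: "j < N" for i j
  proof (intro P.integrable_const_bound[of _ "B * B"] AE_I2)
    fix x
    have "0 \<le> B" using bd[of undefined] by linarith
    then show "norm (w (x i) * w (x j)) \<le> B * B"
      using bd by (auto simp: abs_mult intro!: mult_mono)
  next
    show "(\<lambda>x. w (x i) * w (x j)) \<in> borel_measurable (PiM {..<N} (\<lambda>_. M))"
      using measurable_compose[OF measurable_component_singleton[of i "{..<N}" "\<lambda>_. M"] w]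
        measurable_compose[OF measurable_component_singleton[of j "{..<N}" "\<lambda>_. M"] w] i j
      by (intro borel_measurable_times) auto
  qed
  have "(\<integral>x. (\<Sum>i<N. w (x i))\<^sup>2 \<partial>PiM {..<N} (\<lambda>_. M))
      = (\<integral>x. (\<Sum>i<N. \<Sum>j<N. w (x i) * w (x j)) \<partial>PiM {..<N} (\<lambda>_. M))"
    by (simp add: power2_eq_square sum_product)
  also have "\<dots> = (\<Sum>i<N. \<integral>x. (\<Sum>j<N. w (x i) * w (x j)) \<partial>PiM {..<N} (\<lambda>_. M))"
    using int by (intro Bochner_Integration.integral_sum Bochner_Integration.integrable_sum) auto
  also have "\<dots> = (\<Sum>i<N. \<Sum>j<N. \<integral>x. w (x i) * w (x j) \<partial>PiM {..<N} (\<lambda>_. M))"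
    using int by (intro sum.cong refl Bochner_Integration.integral_sum) auto
  also have "\<dots> = (\<Sum>i<N. \<Sum>j<N. if i = j then \<integral>v. (w v)\<^sup>2 \<partial>M else 0)"
    by (intro sum.cong refl pair) auto
  also have "\<dots> = real N * (\<integral>v. (w v)\<^sup>2 \<partial>M)" by simp
  finally show ?thesis .
qed

text \<open>
  The law will be applied to \<open>g v = v\<^sup>2\<close>, whose square need not be integrable. So \<open>g\<close> is split into
  a truncation, to which the variance bound applies, and a remainder whose average is small in
  mean uniformly in \<open>N\<close>.
\<close>

lemma weak_law_L1:
  fixes g :: "'b \<Rightarrow> real"
  assumes M: "prob_space M" and g: "integrable M g"
  shows "(\<lambda>N. \<integral>x. \<bar>(\<Sum>i<N. g (x i)) / real N - (\<integral>v. g v \<partial>M)\<bar> \<partial>PiM {..<N} (\<lambda>_. M)) \<longlonglongrightarrow> 0"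
    (is "?E \<longlonglongrightarrow> 0")
proof (rule LIMSEQ_I)
  fix e :: real assume e: "0 < e"
  interpret M: prob_space M by fact
  have gm[measurable]: "g \<in> borel_measurable M" using g by simp
  define t where "t K v = max (- real K) (min (real K) (g v))" for K v
  have tm[measurable]: "t K \<in> borel_measurable M" for K unfolding t_def by measurable
  have "(\<lambda>K. \<integral>v. \<bar>g v - t K v\<bar> \<partial>M) \<longlonglongrightarrow> (\<integral>v. 0 \<partial>M)"
  proof (rule integral_dominated_convergence[where w="\<lambda>v. \<bar>g v\<bar>"])
    show "AE v in M. (\<lambda>K. \<bar>g v - t K v\<bar>) \<longlonglongrightarrow> 0"
    proof (rule AE_I2)
      fix v
      have "eventually (\<lambda>K. \<bar>g v - t K v\<bar> = 0) sequentially"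
        using eventually_ge_at_top[of "nat \<lceil>\<bar>g v\<bar>\<rceil>"]
      proof eventually_elim
        case (elim K)
        then have "\<bar>g v\<bar> \<le> real K" by linarith
        then show ?case unfolding t_def by linarith
      qed
      then show "(\<lambda>K. \<bar>g v - t K v\<bar>) \<longlonglongrightarrow> 0" by (rule tendsto_eventually)
    qed
  qed (use g in \<open>auto simp: t_def\<close>)
  then obtain K where "norm ((\<integral>v. \<bar>g v - t K v\<bar> \<partial>M) - 0) < e / 8"
    using LIMSEQ_D[of _ _ "e / 8"] e by fastforce
  then have K: "(\<integral>v. \<bar>g v - t K v\<bar> \<partial>M) < e / 8" by simp
  have tb: "\<bar>t K v\<bar> \<le> real K" for v unfolding t_def by linarith
  have it: "integrable M (t K)" using tb by (intro M.integrable_const_bound[of _ "real K"]) auto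
  define a where "a = (\<integral>v. g v \<partial>M)"
  define y where "y = (\<integral>v. t K v \<partial>M)"
  define w where "w v = t K v - y" for v
  define r where "r v = \<bar>g v - t K v\<bar>" for v
  have [measurable]: "w \<in> borel_measurable M" "r \<in> borel_measurable M" unfolding w_def r_def by measurable
  have yb: "\<bar>y\<bar> \<le> real K"
  proof -
    have "\<bar>y\<bar> \<le> (\<integral>v. \<bar>t K v\<bar> \<partial>M)" unfolding y_def by (rule integral_abs_bound)
    also have "\<dots> \<le> (\<integral>v. real K \<partial>M)" using it tb by (intro integral_mono) auto
    finally show ?thesis by (simp add: M.prob_space)
  qed
  have wb: "\<bar>w v\<bar> \<le> 2 * real K" for v using tb[of v] yb unfolding w_def by linarith
  have w0: "(\<integral>v. w v \<partial>M) = 0" using it by (simp add: w_def y_def M.prob_space)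
  have ir: "integrable M r" unfolding r_def using g it by auto
  have rK: "(\<integral>v. r v \<partial>M) < e / 8" using K by (simp add: r_def)
  have ay: "\<bar>a - y\<bar> \<le> (\<integral>v. r v \<partial>M)"
  proof -
    have "a - y = (\<integral>v. g v - t K v \<partial>M)" using g it by (simp add: a_def y_def)
    then show ?thesis unfolding r_def by (simp add: integral_abs_bound)
  qed
  \<comment> \<open>Chosen such that the truncated average has variance at most \<open>e\<^sup>2 / 32\<close> once \<open>N \<ge> c\<close>.\<close>
  define c where "c = 32 * (2 * real K)\<^sup>2 / e\<^sup>2"
  show "\<exists>no. \<forall>N\<ge>no. norm (?E N - 0) < e"
  proof (intro exI[of _ "nat \<lceil>c\<rceil> + 1"] allI impI)
    fix N assume "nat \<lceil>c\<rceil> + 1 \<le> N"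
    then have N: "0 < N" and Nc: "c \<le> real N" by linarith+
    let ?P = "PiM {..<N} (\<lambda>_. M)"
    interpret P: prob_space ?P by (intro prob_space_PiM M)
    define W where "W x = (\<Sum>i<N. w (x i)) / real N" for x
    define R where "R x = (\<Sum>i<N. r (x i)) / real N" for x
    have [measurable]: "W \<in> borel_measurable ?P" "R \<in> borel_measurable ?P"
      unfolding W_def R_def by measurable
    have Wb: "\<bar>W x\<bar> \<le> 2 * real K" for x
    proof -
      have "\<bar>\<Sum>i<N. w (x i)\<bar> \<le> (\<Sum>i<N. 2 * real K)"
        by (rule order_trans[OF sum_abs]) (intro sum_mono wb)
      then show ?thesis using N by (simp add: W_def field_simps)
    qed
    have iW: "integrable ?P (\<lambda>x. (W x)\<^sup>2)"
      using power_mono[OF Wb abs_ge_zero, of _ 2]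
      by (intro P.integrable_const_bound[of _ "(2 * real K)\<^sup>2"]) auto
    have "(\<integral>x. (W x)\<^sup>2 \<partial>?P) = (real N * (\<integral>v. (w v)\<^sup>2 \<partial>M)) / (real N)\<^sup>2"
      using second_moment_centred_sum[OF M _ wb w0, of N] by (simp add: W_def power_divide)
    also have "\<dots> = (\<integral>v. (w v)\<^sup>2 \<partial>M) / real N" using N by (simp add: power2_eq_square)
    also have "(\<integral>v. (w v)\<^sup>2 \<partial>M) \<le> (\<integral>v. (2 * real K)\<^sup>2 \<partial>M)"
      using power_mono[OF wb abs_ge_zero, of _ 2]
      by (intro integral_mono M.integrable_const_bound[of _ "(2 * real K)\<^sup>2"]) auto
    then have "(\<integral>v. (w v)\<^sup>2 \<partial>M) / real N \<le> (2 * real K)\<^sup>2 / real N"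
      using N by (simp add: M.prob_space divide_right_mono)
    also have "(2 * real K)\<^sup>2 / real N \<le> e\<^sup>2 / 32"
      using Nc N e by (simp add: c_def field_simps)
    finally have W2: "(\<integral>x. (W x)\<^sup>2 \<partial>?P) \<le> e\<^sup>2 / 32" .
    have iR: "integrable ?P R" unfolding R_def
      by (intro Bochner_Integration.integrable_divide Bochner_Integration.integrable_sum integrable_PiM_component M ir) auto
    have "(\<integral>x. R x \<partial>?P) = (\<Sum>i<N. \<integral>x. r (x i) \<partial>?P) / real N"
      unfolding R_def by (simp add: integrable_PiM_component M ir)
    also have "\<dots> = (\<integral>v. r v \<partial>M)" using N by (simp add: integral_PiM_component M)
    finally have R1: "(\<integral>x. R x \<partial>?P) = (\<integral>v. r v \<partial>M)" .
    have pt: "\<bar>(\<Sum>i<N. g (x i)) / real N - a\<bar> \<le> e / 4 + (4 / e) * (W x)\<^sup>2 + R x + (\<integral>v. r v \<partial>M)" for x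
    proof -
      have "(\<Sum>i<N. g (x i)) / real N - a = W x + (\<Sum>i<N. g (x i) - t K (x i)) / real N + (y - a)"
        using N by (simp add: W_def w_def sum_subtractf field_simps)
      moreover have "\<bar>(\<Sum>i<N. g (x i) - t K (x i)) / real N\<bar> \<le> R x"
        unfolding R_def r_def using N by (simp add: abs_divide divide_right_mono sum_abs)
      \<comment> \<open>Turns the bound on the second moment of \<open>W\<close> into one on its first absolute moment.\<close>
      moreover have "\<bar>W x\<bar> \<le> e / 4 + (4 / e) * (W x)\<^sup>2"
      proof -
        have "0 \<le> (\<bar>W x\<bar> - e / 4)\<^sup>2 + (e / 4) * \<bar>W x\<bar>" using e by simp
        then have "(e / 4) * \<bar>W x\<bar> \<le> (e / 4) * (e / 4 + (4 / e) * (W x)\<^sup>2)"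
          using e by (simp add: power2_diff algebra_simps power2_eq_square)
        then show ?thesis using e by (simp add: mult_le_cancel_left_pos)
      qed
      ultimately show ?thesis using ay by linarith
    qed
    have "?E N = (\<integral>x. \<bar>(\<Sum>i<N. g (x i)) / real N - a\<bar> \<partial>?P)" by (simp add: a_def)
    also have "\<dots> \<le> (\<integral>x. e / 4 + (4 / e) * (W x)\<^sup>2 + R x + (\<integral>v. r v \<partial>M) \<partial>?P)"
      using iW iR
      by (intro integral_mono pt) (auto intro!: integrable_abs Bochner_Integration.integrable_diff Bochner_Integration.integrable_divide
         Bochner_Integration.integrable_sum integrable_PiM_component M g)
    also have "\<dots> = e / 4 + (4 / e) * (\<integral>x. (W x)\<^sup>2 \<partial>?P) + 2 * (\<integral>v. r v \<partial>M)"
      using iW iR by (simp add: P.prob_space R1)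
    also have "\<dots> \<le> e / 4 + (4 / e) * (e\<^sup>2 / 32) + 2 * (\<integral>v. r v \<partial>M)"
      using W2 e by (intro add_mono mult_left_mono order_refl) auto
    also have "\<dots> = 3 * e / 8 + 2 * (\<integral>v. r v \<partial>M)" using e by (simp add: power2_eq_square)
    also have "\<dots> < e" using rK e by linarith
    finally have "?E N < e" .
    moreover have "0 \<le> ?E N" by (intro integral_nonneg_AE) auto
    ultimately show "norm (?E N - 0) < e" by simp
  qed
qed

lemma sqnorm_law_L1:
  fixes M :: "real measure"
  assumes M: "prob_space M" and m: "has_bochner_integral M (\<lambda>v. v\<^sup>2) 1"
  shows "(\<lambda>N. \<integral>x. \<bar>sqnorm N x / real N - 1\<bar> \<partial>PiM {..<N} (\<lambda>_. M)) \<longlonglongrightarrow> 0"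
  using weak_law_L1[OF M, of "\<lambda>v. v\<^sup>2"] m
  by (simp add: has_bochner_integral_iff sqnorm_def)

lemma sqnorm_shell_prob:
  fixes M :: "real measure"
  assumes M: "prob_space M" and sM: "sets M = sets borel" and m: "has_bochner_integral M (\<lambda>v. v\<^sup>2) 1"
    and \<eta>: "0 < \<eta>"
  shows "(\<lambda>N. measure (PiM {..<N} (\<lambda>_. M))
     {x \<in> space (PiM {..<N} (\<lambda>_. M)). \<eta> < \<bar>sqnorm N x / real N - 1\<bar>}) \<longlonglongrightarrow> 0"
proof (rule tendsto_sandwich[OF _ _ tendsto_const])
  let ?P = "\<lambda>N::nat. PiM {..<N} (\<lambda>_. M)"
  let ?E = "\<lambda>N::nat. \<integral>x. \<bar>sqnorm N x / real N - 1\<bar> \<partial>?P N"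
  show "(\<lambda>N. ?E N / \<eta>) \<longlonglongrightarrow> 0"
    using tendsto_divide[OF sqnorm_law_L1[OF M m] tendsto_const[of \<eta>]] \<eta> by simp
  show "\<forall>\<^sub>F N in sequentially. measure (?P N) {x \<in> space (?P N). \<eta> < \<bar>sqnorm N x / real N - 1\<bar>} \<le> ?E N / \<eta>"
  proof (intro always_eventually allI)
    fix N
    interpret P: prob_space "?P N" by (intro prob_space_PiM M)
    have [measurable]: "sqnorm N \<in> borel_measurable (?P N)" by (rule sqnorm_borel_measurable) (rule sM)
    have i: "integrable (?P N) (\<lambda>x. \<bar>sqnorm N x / real N - 1\<bar>)"
      unfolding sqnorm_def using m sM
      by (intro integrable_abs Bochner_Integration.integrable_diff Bochner_Integration.integrable_divide Bochner_Integration.integrable_sum)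
        (auto intro!: integrable_PiM_component M simp: has_bochner_integral_iff cong: measurable_cong_sets)
    have "measure (?P N) {x \<in> space (?P N). \<eta> < \<bar>sqnorm N x / real N - 1\<bar>}
      \<le> measure (?P N) {x \<in> space (?P N). \<eta> \<le> \<bar>sqnorm N x / real N - 1\<bar>}"
      by (intro P.finite_measure_mono) auto
    also have "\<dots> \<le> ?E N / \<eta>"
      by (rule integral_Markov_inequality_measure[OF i, of "{}"]) (use \<eta> in auto)
    finally show "measure (?P N) {x \<in> space (?P N). \<eta> < \<bar>sqnorm N x / real N - 1\<bar>} \<le> ?E N / \<eta>" .
  qed
qed auto

text \<open>
  On the full sequence space the Borel sets of the product topology are those of the product
  sigma-algebra; \<open>\<phi>\<close> is extended to that space by ignoring all but the first \<open>k\<close> coordinates.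
\<close>

lemma continuous_map_product_measurable:
  fixes \<phi> :: "(nat \<Rightarrow> real) \<Rightarrow> real"
  assumes "continuous_map (product_topology (\<lambda>_. euclideanreal) {..<k}) euclideanreal \<phi>"
  shows "\<phi> \<in> borel_measurable (PiM {..<k} (\<lambda>_. borel))"
proof -
  define \<psi> where "\<psi> x = \<phi> (restrict x {..<k})" for x :: "nat \<Rightarrow> real"
  have "continuous_map (product_topology (\<lambda>_. euclideanreal) UNIV) (product_topology (\<lambda>_. euclideanreal) {..<k})
    (\<lambda>x. restrict x {..<k})"
    by (auto simp: continuous_map_componentwise intro: continuous_map_product_projection)
  from continuous_map_compose[OF this assms] have "continuous_on UNIV \<psi>"
    by (simp add: euclidean_product_topology o_def \<psi>_def[abs_def])
  then have "\<psi> \<in> borel_measurable borel" by (rule borel_measurable_continuous_onI)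
  then have \<psi>: "\<psi> \<in> borel_measurable (PiM UNIV (\<lambda>_. borel))"
    by (simp add: sets_PiM_equal_borel cong: measurable_cong_sets)
  have "(\<lambda>x i. if i < k then x i else 0 :: real) \<in> measurable (PiM {..<k} (\<lambda>_. borel)) (PiM UNIV (\<lambda>_. borel))"
  proof (rule measurable_PiM_single')
    fix i :: nat
    show "(\<lambda>x. if i < k then x i else 0 :: real) \<in> borel_measurable (PiM {..<k} (\<lambda>_. borel))"
      by (cases "i < k") auto
  qed auto
  from measurable_compose[OF this \<psi>]
  have "(\<lambda>x. \<psi> (\<lambda>i. if i < k then x i else 0)) \<in> borel_measurable (PiM {..<k} (\<lambda>_. borel))" .
  moreover have "\<psi> (\<lambda>i. if i < k then x i else 0) = \<phi> x" if "x \<in> space (PiM {..<k} (\<lambda>_. borel))" for x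
  proof -
    have "restrict (\<lambda>i. if i < k then x i else 0) {..<k} = x"
      using that by (auto simp: space_PiM PiE_iff extensional_def fun_eq_iff)
    then show ?thesis by (simp add: \<psi>_def)
  qed
  ultimately show ?thesis by (simp cong: measurable_cong)
qed

lemma LIMSEQ_if_subseq_refine:
  fixes a :: "nat \<Rightarrow> real"
  assumes "\<And>r :: nat \<Rightarrow> nat. strict_mono r \<Longrightarrow> \<exists>s :: nat \<Rightarrow> nat. strict_mono s \<and> (\<lambda>n. a (r (s n))) \<longlonglongrightarrow> l"
  shows "a \<longlonglongrightarrow> l"
proof (rule ccontr)
  assume "\<not> a \<longlonglongrightarrow> l"
  then obtain e where e: "0 < e" and "\<forall>N. \<exists>n\<ge>N. e \<le> \<bar>a n - l\<bar>"
    unfolding LIMSEQ_iff by (auto simp: not_less)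
  then have "infinite {n. e \<le> \<bar>a n - l\<bar>}"
    unfolding infinite_nat_iff_unbounded_le by auto
  then obtain r :: "nat \<Rightarrow> nat" where r: "strict_mono r" "\<And>n. r n \<in> {n. e \<le> \<bar>a n - l\<bar>}"
    using infinite_enumerate by blast
  from assms[OF r(1)] obtain s :: "nat \<Rightarrow> nat" where "(\<lambda>n. a (r (s n))) \<longlonglongrightarrow> l" by blast
  from LIMSEQ_D[OF this e] obtain n where "\<bar>a (r (s n)) - l\<bar> < e" by auto
  with r(2)[of "s n"] show False by simp
qed

definition projected_law :: "real measure \<Rightarrow> nat \<Rightarrow> (nat \<Rightarrow> real) measure" where
  "projected_law M N = distr (PiM {..<N} (\<lambda>_. M)) (sphere_space N) (radial_proj N)"

lemma radial_proj_restrict: "radial_proj N (restrict x {..<N}) = radial_proj N x"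
  by (auto simp: radial_proj_def sqnorm_def fun_eq_iff)

text \<open>
  All \<open>N\<close> are realised on one infinite product space. There the normalised square norm tends to
  \<open>1\<close> in \<open>L\<^sup>1\<close>, hence almost surely along a subsequence of any given subsequence, and along it the
  projected points converge coordinatewise to the unprojected one.
\<close>

lemma projected_law_chaotic:
  fixes M :: "real measure"
  assumes M: "prob_space M" and sM: "sets M = sets borel" and m: "has_bochner_integral M (\<lambda>v. v\<^sup>2) 1"
  shows "weakly_converges k (\<lambda>N. marginal k (projected_law M N)) (PiM {..<k} (\<lambda>_. M))"
  unfolding weakly_converges_def
proof (intro allI impI)
  fix \<phi> :: "(nat \<Rightarrow> real) \<Rightarrow> real"
  assume cont: "continuous_map (product_topology (\<lambda>_. euclideanreal) {..<k}) euclideanreal \<phi>"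
    and bdd: "bounded (\<phi> ` topspace (product_topology (\<lambda>_. euclideanreal) {..<k}))"
  let ?\<Omega> = "PiM UNIV (\<lambda>_::nat. M)"
  interpret \<Omega>: product_prob_space "\<lambda>_::nat. M" UNIV
    using M by (simp add: product_prob_space_def product_prob_space_axioms_def product_sigma_finite_def
       prob_space_imp_sigma_finite)
  have \<phi>m[measurable]: "\<phi> \<in> borel_measurable (PiM {..<k} (\<lambda>_. borel))"
    by (rule continuous_map_product_measurable[OF cont])
  obtain B where B: "\<And>x. x \<in> extensional {..<k} \<Longrightarrow> \<bar>\<phi> x\<bar> \<le> B"
    using bdd by (auto simp: bounded_iff PiE_def)
  have rM[measurable]: "(\<lambda>x. restrict x {..<N}) \<in> measurable ?\<Omega> (PiM {..<N} (\<lambda>_. M))" for N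
    by (rule measurable_restrict_subset) simp
  have rk: "(\<lambda>x. restrict x {..<k}) \<in> measurable (PiM {..<N} (\<lambda>_. borel)) (PiM {..<k} (\<lambda>_. borel))"
    if "k \<le> N" for N using that by (intro measurable_restrict_subset) auto
  have sPk: "sets (PiM {..<k} (\<lambda>_. M)) = sets (PiM {..<k} (\<lambda>_. borel))" for k
    by (rule sets_PiM_cong) (simp_all add: sM)
  have \<phi>M: "\<phi> \<in> borel_measurable (PiM {..<k} (\<lambda>_. M))"
    using \<phi>m measurable_cong_sets[OF sPk[of k] refl] by blast
  have pm[measurable]: "radial_proj N \<in> measurable (PiM {..<N} (\<lambda>_. M)) (sphere_space N)" for N
    by (rule radial_proj_PiM_measurable) (rule sM)
  have proj: "distr ?\<Omega> (PiM {..<N} (\<lambda>_. M)) (\<lambda>x. restrict x {..<N}) = PiM {..<N} (\<lambda>_. M)" for N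
    by (rule \<Omega>.distr_PiM_restrict_finite) auto
  define u where "u N x = sqnorm N x / real N - 1" for N x
  have um: "u N \<in> borel_measurable (PiM {..<N} (\<lambda>_. M))" for N
    using sqnorm_borel_measurable[of N "\<lambda>_. M"] sM unfolding u_def by measurable
  have ur: "u N (restrict x {..<N}) = u N x" for N x by (simp add: u_def sqnorm_def)
  have ui: "integrable (PiM {..<N} (\<lambda>_. M)) (u N)" for N
  proof -
    interpret P: prob_space "PiM {..<N} (\<lambda>_. M)" by (intro prob_space_PiM M)
    show ?thesis unfolding u_def sqnorm_def using m sM
      by (intro Bochner_Integration.integrable_diff Bochner_Integration.integrable_divide Bochner_Integration.integrable_sum)
        (auto intro!: integrable_PiM_component M simp: has_bochner_integral_iff cong: measurable_cong_sets)
  qed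
  have ui\<Omega>: "integrable ?\<Omega> (u N)" for N
    using integrable_distr[OF rM[of N], where f="u N"] ui[of N] by (simp add: proj ur)
  have uL: "(\<lambda>N. \<integral>x. norm (u N x) \<partial>?\<Omega>) \<longlonglongrightarrow> 0"
  proof -
    have "(\<integral>x. norm (u N x) \<partial>?\<Omega>) = (\<integral>x. \<bar>u N x\<bar> \<partial>PiM {..<N} (\<lambda>_. M))" for N
      using integral_distr[OF rM[of N], where f="\<lambda>x. \<bar>u N x\<bar>"] um[of N] by (simp add: proj ur)
    then show ?thesis using sqnorm_law_L1[OF M m] by (simp add: u_def)
  qed
  define a where "a N = (\<integral>x. \<phi> (restrict (radial_proj N x) {..<k}) \<partial>?\<Omega>)" for N
  define l where "l = (\<integral>x. \<phi> (restrict x {..<k}) \<partial>?\<Omega>)"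
  have sphere_m: "(\<lambda>x. restrict x {..<k}) \<in> measurable (sphere_space N) (PiM {..<k} (\<lambda>_. borel))"
    if "k \<le> N" for N
    unfolding sphere_space_def by (intro measurable_restrict_space1 rk that)
  have projm: "(\<lambda>x. restrict (radial_proj N x) {..<k}) \<in> measurable ?\<Omega> (PiM {..<k} (\<lambda>_. borel))"
    if "k \<le> N" for N
    using measurable_compose[OF measurable_compose[OF rM[of N] pm] sphere_m[OF that]]
    by (simp add: radial_proj_restrict)
  have a: "(\<integral>x. \<phi> x \<partial>marginal k (projected_law M N)) = a N" if N: "k \<le> N" for N
  proof -
    have "(\<integral>x. \<phi> x \<partial>marginal k (projected_law M N)) = (\<integral>x. \<phi> (restrict x {..<k}) \<partial>projected_law M N)"
      unfolding marginal_def using sphere_m[OF N] by (intro integral_distr) (auto simp: projected_law_def)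
    also have "\<dots> = (\<integral>x. \<phi> (restrict (radial_proj N x) {..<k}) \<partial>PiM {..<N} (\<lambda>_. M))"
      unfolding projected_law_def by (rule integral_distr[OF pm measurable_compose[OF sphere_m[OF N] \<phi>m]])
    also have "\<dots> = (\<integral>x. \<phi> (restrict (radial_proj N (restrict x {..<N})) {..<k}) \<partial>?\<Omega>)"
      by (subst proj[symmetric], rule integral_distr[OF rM
          measurable_compose[OF measurable_compose[OF pm sphere_m[OF N]] \<phi>m]])
    finally show ?thesis by (simp add: radial_proj_restrict a_def)
  qed
  have l: "(\<integral>x. \<phi> x \<partial>PiM {..<k} (\<lambda>_. M)) = l"
    unfolding l_def by (subst proj[symmetric], rule integral_distr[OF rM \<phi>M])
  have "(\<lambda>N. a (N + k)) \<longlonglongrightarrow> l"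
  proof (rule LIMSEQ_if_subseq_refine)
    fix r :: "nat \<Rightarrow> nat" assume r: "strict_mono r"
    let ?q = "\<lambda>n. r n + k"
    have q: "strict_mono ?q" using r by (simp add: strict_mono_def)
    have "(\<lambda>n. \<integral>x. norm (u (?q n) x) \<partial>?\<Omega>) \<longlonglongrightarrow> 0"
      using LIMSEQ_subseq_LIMSEQ[OF uL q] by (simp add: o_def)
    from tendsto_L1_AE_subseq[OF ui\<Omega> this]
    obtain s where s: "strict_mono s" and AE: "AE x in ?\<Omega>. (\<lambda>n. u (?q (s n)) x) \<longlonglongrightarrow> 0" by blast
    define p where "p n = ?q (s n)" for n
    have p: "strict_mono p" using q s by (simp add: strict_mono_def p_def)
    have pk: "k \<le> p n" for n by (simp add: p_def)
    have "(\<lambda>n. a (p n)) \<longlonglongrightarrow> l"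
      unfolding a_def l_def
    proof (rule integral_dominated_convergence[where w="\<lambda>_. B"])
      show "(\<lambda>x. \<phi> (restrict x {..<k})) \<in> borel_measurable ?\<Omega>"
        by (rule measurable_compose[OF rM[of k] \<phi>M])
      show "(\<lambda>x. \<phi> (restrict (radial_proj (p n) x) {..<k})) \<in> borel_measurable ?\<Omega>" for n
        by (intro measurable_compose[OF projm[OF pk] \<phi>m])
      show "AE x in ?\<Omega>. (\<lambda>n. \<phi> (restrict (radial_proj (p n) x) {..<k})) \<longlonglongrightarrow> \<phi> (restrict x {..<k})"
        using AE
      proof eventually_elim
        case (elim x)
        then have u0: "(\<lambda>n. u (p n) x) \<longlonglongrightarrow> 0" by (simp add: p_def)
        have c: "(\<lambda>n. radial_proj (p n) x i) \<longlonglongrightarrow> x i" for i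
        proof -
          have "(\<lambda>n. x i / sqrt (1 + u (p n) x)) \<longlonglongrightarrow> x i / sqrt (1 + 0)"
            using u0 by (intro tendsto_intros) auto
          moreover have "eventually (\<lambda>n. x i / sqrt (1 + u (p n) x) = radial_proj (p n) x i) sequentially"
          proof -
            have "eventually (\<lambda>n. - 1 < u (p n) x) sequentially"
              using order_tendstoD(1)[OF u0, of "- 1"] by simp
            with filterlim_subseq[OF p, unfolded filterlim_at_top, rule_format, of "Suc i"]
            show ?thesis
            proof eventually_elim
              case (elim n)
              then have pn: "0 < p n" "i < p n" by auto
              with elim have "0 < sqnorm (p n) x / real (p n)" by (simp add: u_def)
              then have "0 < sqnorm (p n) x" using pn by (simp add: zero_less_divide_iff)
              then show ?case using pn
                by (simp add: radial_proj_def u_def real_sqrt_divide mult.commute)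
            qed
          qed
          ultimately show ?thesis by (simp add: filterlim_cong[OF refl refl] Lim_transform_eventually)
        qed
        have "limitin (product_topology (\<lambda>_. euclideanreal) {..<k})
          (\<lambda>n. restrict (radial_proj (p n) x) {..<k}) (restrict x {..<k}) sequentially"
          using c by (auto simp: limitin_componentwise)
        from continuous_map_limit[OF cont this] show ?case by (simp add: o_def)
      qed
      show "AE x in ?\<Omega>. norm (\<phi> (restrict (radial_proj (p n) x) {..<k})) \<le> B" for n
        using B by (intro AE_I2) auto
    qed simp
    then show "\<exists>s. strict_mono s \<and> (\<lambda>n. a (r (s n) + k)) \<longlonglongrightarrow> l" using s by (auto simp: p_def)
  qed
  then have "a \<longlonglongrightarrow> l" by (rule LIMSEQ_offset)
  moreover have "eventually (\<lambda>N. a N = (\<integral>x. \<phi> x \<partial>marginal k (projected_law M N))) sequentially"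
    using eventually_ge_at_top[of k] by eventually_elim (simp add: a)
  ultimately show "(\<lambda>N. \<integral>x. \<phi> x \<partial>marginal k (projected_law M N)) \<longlonglongrightarrow> (\<integral>x. \<phi> x \<partial>PiM {..<k} (\<lambda>_. M))"
    unfolding l by (rule Lim_transform_eventually)
qed

lemma projected_law_prob:
  assumes M: "prob_space M" and sM: "sets M = sets borel"
  shows "prob_space (projected_law M N)"
  unfolding projected_law_def
  by (intro prob_space.prob_space_distr prob_space_PiM M radial_proj_PiM_measurable sM)

text \<open>
  Permuting coordinates commutes with the radial projection and preserves the product measure.
\<close>

lemma projected_law_symmetric:
  fixes M :: "real measure"
  assumes M: "prob_space M" and sM: "sets M = sets borel"
  shows "symmetric_measure N (projected_law M N)"
  unfolding symmetric_measure_def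
proof (intro allI impI)
  fix p assume p: "p permutes {..<N}"
  let ?P = "PiM {..<N} (\<lambda>_. M)" and ?S = "sphere_space N"
  let ?\<pi> = "\<lambda>x. \<lambda>i\<in>{..<N}. x (p i)"
  have pN: "p i < N" if "i < N" for i using permutes_in_image[OF p, of i] that by simp
  have pm[measurable]: "radial_proj N \<in> measurable ?P ?S"
    by (rule radial_proj_PiM_measurable) (rule sM)
  have sq: "sqnorm N (?\<pi> x) = sqnorm N x" for x
    using sum.permute[OF p, of "\<lambda>i. (x i)\<^sup>2"] by (simp add: sqnorm_def o_def)
  have "?\<pi> \<in> measurable (PiM {..<N} (\<lambda>_. borel)) (PiM {..<N} (\<lambda>_. borel :: real measure))"
    using pN by (intro measurable_restrict measurable_component_singleton) auto
  then have \<pi>S: "?\<pi> \<in> measurable ?S ?S"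
    unfolding sphere_space_def
    by (intro measurable_restrict_space2 measurable_restrict_space1)
       (auto simp: space_restrict_space sq)
  have \<pi>P: "?\<pi> \<in> measurable ?P ?P"
    using pN by (intro measurable_restrict measurable_component_singleton) auto
  have comm: "?\<pi> (radial_proj N x) = radial_proj N (?\<pi> x)" for x
    using pN by (auto simp: radial_proj_def sq fun_eq_iff)
  have inv: "distr ?P ?P ?\<pi> = ?P"
    using distr_PiM_reindex[of "{..<N}" "\<lambda>_. M" p "{..<N}"] M permutes_inj_on[OF p] pN by auto
  have "distr (projected_law M N) (projected_law M N) ?\<pi> = distr (projected_law M N) ?S ?\<pi>"
    by (intro distr_cong) (simp_all add: projected_law_def)
  also have "\<dots> = distr ?P ?S (?\<pi> \<circ> radial_proj N)"
    unfolding projected_law_def by (intro distr_distr \<pi>S pm)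
  also have "?\<pi> \<circ> radial_proj N = radial_proj N \<circ> ?\<pi>" by (rule ext) (simp add: comm)
  also have "distr ?P ?S \<dots> = distr (distr ?P ?P ?\<pi>) ?S (radial_proj N)"
    by (intro distr_distr[symmetric] pm \<pi>P)
  also have "\<dots> = projected_law M N" by (simp only: inv projected_law_def)
  finally show "distr (projected_law M N) (projected_law M N) ?\<pi> = projected_law M N" .
qed

section \<open>The entropy does not increase under projection\<close>

text \<open>
  The uniform measure on the sphere is the radial projection of the Gaussian product measure, so
  additivity of entropy on products and the data processing inequality give the bound.
\<close>

lemma
  fixes M :: "real measure"
  assumes M: "prob_space M" and sM: "sets M = sets borel" and ac: "absolutely_continuous gauss_measure M"
    and N: "0 < N"
  shows projected_law_absolutely_continuous: "absolutely_continuous (unif_sphere N) (projected_law M N)"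
    and projected_law_entropy_le: "rel_entropy M gauss_measure \<le> ereal C \<Longrightarrow>
       rel_entropy (projected_law M N) (unif_sphere N) \<le> ereal (real N * C)"
proof -
  have s: "sets M = sets gauss_measure" using sM by simp
  have sP: "sets (PiM {..<N} (\<lambda>_. M)) = sets (gauss_prod N)" by (intro sets_PiM_cong) (simp_all add: sM)
  have acP: "absolutely_continuous (gauss_prod N) (PiM {..<N} (\<lambda>_. M))"
    by (intro absolutely_continuous_PiM prob_space_gauss_measure M s ac) simp
  have PM: "prob_space (PiM {..<N} (\<lambda>_. M))" by (intro prob_space_PiM M)
  show "absolutely_continuous (unif_sphere N) (projected_law M N)"
    unfolding projected_law_def radial_proj_gauss[OF N, symmetric]
    by (rule absolutely_continuous_distr[OF radial_proj_gauss_measurable sP acP])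
  assume "rel_entropy M gauss_measure \<le> ereal C"
  from rel_entropy_PiM_le[OF finite_lessThan prob_space_gauss_measure M s ac this, of N]
  have "rel_entropy (PiM {..<N} (\<lambda>_. M)) (gauss_prod N) \<le> ereal (real N * C)" by simp
  from rel_entropy_distr_le[OF prob_space_gauss_prod PM sP acP this radial_proj_gauss_measurable]
  show "rel_entropy (projected_law M N) (unif_sphere N) \<le> ereal (real N * C)"
    by (simp add: projected_law_def radial_proj_gauss[OF N])
qed

section \<open>The entropy does not drop in the limit\<close>

text \<open>
  Dilations displace points at distance \<open>r\<close> by an amount proportional to \<open>r\<close>, so uniform continuity
  alone would not suffice; compact support confines the relevant points to a bounded interval.
\<close>

lemma uniform_under_small_dilations:
  fixes \<psi> :: "real \<Rightarrow> real"
  assumes cont: "continuous_on UNIV \<psi>" and supp: "\<And>x. R < \<bar>x\<bar> \<Longrightarrow> \<psi> x = 0" and R: "0 < R"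
    and \<epsilon>: "0 < \<epsilon>"
  obtains \<eta> where "0 < \<eta>" "\<eta> < 1" "\<And>t x. \<bar>t - 1\<bar> \<le> \<eta> \<Longrightarrow> \<bar>\<psi> (x / sqrt t) - \<psi> x\<bar> \<le> \<epsilon>"
proof -
  have "uniformly_continuous_on {-4 * R..4 * R} \<psi>"
    using cont by (intro compact_uniformly_continuous continuous_on_subset[OF cont]) auto
  then obtain d where d: "0 < d"
    and dd: "\<And>x y. x \<in> {-4 * R..4 * R} \<Longrightarrow> y \<in> {-4 * R..4 * R} \<Longrightarrow> dist y x < d \<Longrightarrow> dist (\<psi> y) (\<psi> x) < \<epsilon>"
    using \<epsilon> unfolding uniformly_continuous_on_def by blast
  have "isCont (\<lambda>t. 1 / sqrt t) 1" by (intro continuous_intros) auto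
  then obtain \<eta>0 where \<eta>0: "0 < \<eta>0" and close: "\<And>t. \<bar>t - 1\<bar> < \<eta>0 \<Longrightarrow> \<bar>1 / sqrt t - 1\<bar> < d / (2 * R)"
    using d R unfolding continuous_at_eps_delta dist_real_def
    by (metis divide_pos_pos mult_pos_pos real_sqrt_one div_by_1 zero_less_numeral)
  \<comment> \<open>The bound \<open>1 / 2\<close> keeps \<open>sqrt t\<close> within \<open>[1/2, 2]\<close>, so that a point outside \<open>[-2R, 2R]\<close> stays
      outside the support after dilation.\<close>
  define \<eta> where "\<eta> = min (\<eta>0 / 2) (1 / 2)"
  have \<eta>: "0 < \<eta>" "\<eta> < 1" "\<eta> < \<eta>0" "\<eta> \<le> 1 / 2" using \<eta>0 by (auto simp: \<eta>_def)
  have "\<bar>\<psi> (x / sqrt t) - \<psi> x\<bar> \<le> \<epsilon>" if t: "\<bar>t - 1\<bar> \<le> \<eta>" for t x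
  proof -
    have t4: "1 / 4 \<le> t" "t \<le> 4" using t \<eta> by linarith+
    have st: "1 / 2 \<le> sqrt t" "sqrt t \<le> 2"
      using real_sqrt_le_mono[OF t4(1)] real_sqrt_le_mono[OF t4(2)] by (simp_all add: real_sqrt_divide)
    then have st0: "0 < sqrt t" by linarith
    show ?thesis
    proof (cases "\<bar>x\<bar> \<le> 2 * R")
      case True
      have eq: "\<bar>x / sqrt t - x\<bar> = \<bar>x\<bar> * \<bar>1 / sqrt t - 1\<bar>"
        by (simp add: abs_mult[symmetric] right_diff_distrib)
      have "\<bar>1 / sqrt t - 1\<bar> < d / (2 * R)" using t \<eta> by (intro close) linarith
      have "\<bar>x\<bar> * \<bar>1 / sqrt t - 1\<bar> \<le> (2 * R) * \<bar>1 / sqrt t - 1\<bar>"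
        using True by (intro mult_right_mono) auto
      also have "\<dots> < (2 * R) * (d / (2 * R))"
        using \<open>\<bar>1 / sqrt t - 1\<bar> < d / (2 * R)\<close> R by (intro mult_strict_left_mono) auto
      finally have "dist (x / sqrt t) x < d" using R by (simp add: dist_real_def eq)
      moreover have "\<bar>x / sqrt t\<bar> \<le> 4 * R"
      proof -
        have "\<bar>x\<bar> \<le> 4 * R * (1 / 2)" using True by simp
        also have "\<dots> \<le> 4 * R * sqrt t" using st R by (intro mult_left_mono) auto
        finally show ?thesis using st0 by (simp add: abs_divide divide_le_eq)
      qed
      then have "- 4 * R \<le> x / sqrt t" "x / sqrt t \<le> 4 * R" by linarith+
      ultimately have "dist (\<psi> (x / sqrt t)) (\<psi> x) < \<epsilon>" using True R by (intro dd) auto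
      then show ?thesis by (simp add: dist_real_def)
    next
      case False
      then have "R * sqrt t < \<bar>x\<bar>"
        using mult_left_mono[OF st(2), of R] R by linarith
      then have "R < \<bar>x / sqrt t\<bar>" using st0 by (simp add: abs_divide less_divide_eq)
      then show ?thesis using False R \<epsilon> by (simp add: supp)
    qed
  qed
  with \<eta> that show thesis by blast
qed

lemma radial_proj_sqrt:
  assumes "0 < N" "0 < sqnorm N x" "i < N"
  shows "radial_proj N x i = x i / sqrt (sqnorm N x / real N)"
  using assms by (simp add: radial_proj_def real_sqrt_divide mult.commute)

lemma sphere_component_measurable:
  "i < N \<Longrightarrow> (\<lambda>x. x i) \<in> borel_measurable (sphere_space N)"
  unfolding sphere_space_def by (intro measurable_restrict_space1 measurable_component_singleton) auto

lemma sphere_sum_measurable: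
  assumes "\<psi> \<in> borel_measurable borel"
  shows "(\<lambda>x. \<Sum>i<N. \<psi> (x i) :: real) \<in> borel_measurable (sphere_space N)"
  using measurable_compose[OF sphere_component_measurable assms] by (intro borel_measurable_sum) auto

lemma abs_sum_coordinates_le:
  fixes \<psi> :: "'b \<Rightarrow> real"
  assumes "\<And>v. \<bar>\<psi> v\<bar> \<le> B"
  shows "\<bar>\<Sum>i<N. \<psi> (x i)\<bar> \<le> real N * B"
proof -
  have "\<bar>\<Sum>i<N. \<psi> (x i)\<bar> \<le> (\<Sum>i<N. B)"
    by (rule order_trans[OF sum_abs]) (intro sum_mono assms)
  then show ?thesis by simp
qed

lemma sum_radial_proj_close:
  assumes N: "0 < N" and \<eta>: "\<eta> < 1"
    and dil: "\<And>t x. \<bar>t - 1\<bar> \<le> \<eta> \<Longrightarrow> \<bar>\<psi> (x / sqrt t) - \<psi> x\<bar> \<le> \<epsilon>"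
    and x: "\<bar>sqnorm N x / real N - 1\<bar> \<le> \<eta>"
  shows "\<bar>(\<Sum>i<N. \<psi> (radial_proj N x i)) - (\<Sum>i<N. \<psi> (x i))\<bar> \<le> real N * \<epsilon>"
proof -
  have "0 < sqnorm N x / real N" using x \<eta> by linarith
  then have s: "0 < sqnorm N x" using N by (simp add: zero_less_divide_iff)
  have "\<bar>(\<Sum>i<N. \<psi> (radial_proj N x i)) - (\<Sum>i<N. \<psi> (x i))\<bar>
     \<le> (\<Sum>i<N. \<bar>\<psi> (radial_proj N x i) - \<psi> (x i)\<bar>)"
    unfolding sum_subtractf[symmetric] by (rule sum_abs)
  also have "\<dots> \<le> (\<Sum>i<N. \<epsilon>)"
    using dil[OF x] by (intro sum_mono) (simp add: radial_proj_sqrt[OF N s])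
  finally show ?thesis by simp
qed

text \<open>
  Direction and radius being independent under the Gaussian, the sphere average may be taken over
  the shell only; there projecting changes each summand by at most \<open>\<epsilon>\<close>, and dropping the
  restriction to the shell leaves a product of one-dimensional integrals.
\<close>

lemma sphere_exp_moment_le:
  fixes \<psi> :: "real \<Rightarrow> real"
  assumes N: "0 < N" and \<psi>[measurable]: "\<psi> \<in> borel_measurable borel" and bd: "\<And>v. \<bar>\<psi> v\<bar> \<le> B"
    and \<eta>: "\<eta> < 1"
    and dil: "\<And>t x. \<bar>t - 1\<bar> \<le> \<eta> \<Longrightarrow> \<bar>\<psi> (x / sqrt t) - \<psi> x\<bar> \<le> \<epsilon>"
  shows "measure (gauss_prod N) {x \<in> space (gauss_prod N). \<bar>sqnorm N x / real N - 1\<bar> \<le> \<eta>} *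
      (\<integral>x. exp (\<Sum>i<N. \<psi> (x i)) \<partial>unif_sphere N)
    \<le> exp (real N * \<epsilon>) * (\<integral>v. exp (\<psi> v) \<partial>gauss_measure) ^ N"
proof -
  let ?G = "gauss_prod N" and ?S = "unif_sphere N"
  interpret G: prob_space ?G by (rule prob_space_gauss_prod)
  interpret S: prob_space ?S by (rule prob_space_unif_sphere)
  interpret g: prob_space gauss_measure by (rule prob_space_gauss_measure)
  interpret product_sigma_finite "\<lambda>_::nat. gauss_measure" by standard
  have sq[measurable]: "sqnorm N \<in> borel_measurable ?G" by (rule sqnorm_borel_measurable) simp
  define T where "T = {s. \<bar>s / real N - 1\<bar> \<le> \<eta>}"
  have T[measurable]: "T \<in> sets borel" unfolding T_def by measurable
  have \<Phi>[measurable]: "(\<lambda>x. \<Sum>i<N. \<psi> (x i)) \<in> borel_measurable (sphere_space N)"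
    by (rule sphere_sum_measurable[OF \<psi>])
  have \<Phi>S: "(\<lambda>x. \<Sum>i<N. \<psi> (x i)) \<in> borel_measurable ?S"
    using \<Phi> sets_unif_sphere by (simp cong: measurable_cong_sets)
  have \<Phi>b: "(\<Sum>i<N. \<psi> (x i)) \<le> real N * B" for x
    using sum_mono[of "{..<N}" "\<lambda>i. \<psi> (x i)" "\<lambda>_. B"] bd by (simp add: abs_le_iff)
  have iS: "integrable ?S (\<lambda>x. exp (\<Sum>i<N. \<psi> (x i)))"
    using \<Phi>S \<Phi>b by (intro S.integrable_const_bound[of _ "exp (real N * B)"]) auto
  have \<psi>g: "\<psi> \<in> borel_measurable gauss_measure" using \<psi> by (simp cong: measurable_cong_sets)
  have ig: "integrable gauss_measure (\<lambda>v. exp (\<psi> v))"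
    by (rule g.exp_bounded_integral[OF \<psi>g bd])
  have "ennreal (measure ?G {x \<in> space ?G. sqnorm N x \<in> T} * (\<integral>x. exp (\<Sum>i<N. \<psi> (x i)) \<partial>?S))
    = emeasure ?G {x \<in> space ?G. sqnorm N x \<in> T} * (\<integral>\<^sup>+x. ennreal (exp (\<Sum>i<N. \<psi> (x i))) \<partial>?S)"
    using iS by (simp add: G.emeasure_eq_measure nn_integral_eq_integral ennreal_mult')
  also have "\<dots> = (\<integral>\<^sup>+x. ennreal (exp (\<Sum>i<N. \<psi> (radial_proj N x i))) * indicator T (sqnorm N x) \<partial>?G)"
    by (rule nn_integral_gauss_shell[OF N T, symmetric]) measurable
  also have "\<dots> \<le> (\<integral>\<^sup>+x. ennreal (exp (real N * \<epsilon>)) * (\<Prod>i<N. ennreal (exp (\<psi> (x i)))) \<partial>?G)"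
  proof (rule nn_integral_mono)
    fix x
    show "ennreal (exp (\<Sum>i<N. \<psi> (radial_proj N x i))) * indicator T (sqnorm N x)
      \<le> ennreal (exp (real N * \<epsilon>)) * (\<Prod>i<N. ennreal (exp (\<psi> (x i))))"
    proof (cases "sqnorm N x \<in> T")
      case True
      then have "\<bar>(\<Sum>i<N. \<psi> (radial_proj N x i)) - (\<Sum>i<N. \<psi> (x i))\<bar> \<le> real N * \<epsilon>"
        by (intro sum_radial_proj_close[OF N \<eta> dil]) (auto simp: T_def)
      then have "exp (\<Sum>i<N. \<psi> (radial_proj N x i)) \<le> exp (real N * \<epsilon> + (\<Sum>i<N. \<psi> (x i)))"
        by simp
      also have "\<dots> = exp (real N * \<epsilon>) * (\<Prod>i<N. exp (\<psi> (x i)))"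
        by (simp add: exp_add exp_sum)
      finally show ?thesis using True
        by (simp add: prod_ennreal ennreal_mult'[symmetric] ennreal_leI)
    qed simp
  qed
  also have "\<dots> = ennreal (exp (real N * \<epsilon>)) * (\<integral>\<^sup>+x. (\<Prod>i<N. ennreal (exp (\<psi> (x i)))) \<partial>?G)"
  proof (rule nn_integral_cmult)
    have "(\<lambda>x. \<psi> (x i)) \<in> borel_measurable ?G" if "i < N" for i
      using measurable_compose[OF measurable_component_singleton[of i "{..<N}" "\<lambda>_. gauss_measure"] \<psi>g] that
      by simp
    then show "(\<lambda>x. \<Prod>i<N. ennreal (exp (\<psi> (x i)))) \<in> borel_measurable ?G"
      by (intro borel_measurable_prod_ennreal) auto
  qed
  also have "(\<integral>\<^sup>+x. (\<Prod>i<N. ennreal (exp (\<psi> (x i)))) \<partial>?G) = (\<Prod>i<N. \<integral>\<^sup>+v. ennreal (exp (\<psi> v)) \<partial>gauss_measure)"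
    by (intro product_nn_integral_prod measurable_compose[OF \<psi>g, of "\<lambda>r. ennreal (exp r)"]) auto
  also have "\<dots> = ennreal ((\<integral>v. exp (\<psi> v) \<partial>gauss_measure) ^ N)"
    using ig by (simp add: nn_integral_eq_integral ennreal_power)
  also have "ennreal (exp (real N * \<epsilon>)) * \<dots> = ennreal (exp (real N * \<epsilon>) * (\<integral>v. exp (\<psi> v) \<partial>gauss_measure) ^ N)"
    by (simp add: ennreal_mult')
  finally show ?thesis by (simp add: T_def ennreal_le_iff)
qed

text \<open>
  On the shell the projection changes each summand by at most \<open>\<epsilon>\<close>; off it, the whole sum changes
  by at most \<open>2 N B\<close>.
\<close>

lemma projected_law_mean_ge:
  fixes \<psi> :: "real \<Rightarrow> real"
  assumes M: "prob_space M" and sM: "sets M = sets borel"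
    and N: "0 < N" and \<psi>[measurable]: "\<psi> \<in> borel_measurable borel" and bd: "\<And>v. \<bar>\<psi> v\<bar> \<le> B"
    and \<eta>: "\<eta> < 1" and \<epsilon>: "0 \<le> \<epsilon>"
    and dil: "\<And>t x. \<bar>t - 1\<bar> \<le> \<eta> \<Longrightarrow> \<bar>\<psi> (x / sqrt t) - \<psi> x\<bar> \<le> \<epsilon>"
  shows "real N * ((\<integral>v. \<psi> v \<partial>M) - \<epsilon> - 2 * B * measure (PiM {..<N} (\<lambda>_. M))
       {x \<in> space (PiM {..<N} (\<lambda>_. M)). \<eta> < \<bar>sqnorm N x / real N - 1\<bar>})
    \<le> (\<integral>x. (\<Sum>i<N. \<psi> (x i)) \<partial>projected_law M N)"
proof -
  let ?P = "PiM {..<N} (\<lambda>_. M)"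
  interpret M: prob_space M by fact
  interpret P: prob_space ?P by (intro prob_space_PiM M)
  have sq[measurable]: "sqnorm N \<in> borel_measurable ?P" by (rule sqnorm_borel_measurable) (rule sM)
  have pm[measurable]: "radial_proj N \<in> measurable ?P (sphere_space N)"
    by (rule radial_proj_PiM_measurable) (rule sM)
  define X where "X = {x \<in> space ?P. \<eta> < \<bar>sqnorm N x / real N - 1\<bar>}"
  have X[measurable]: "X \<in> sets ?P" unfolding X_def by measurable
  have \<psi>M[measurable]: "\<psi> \<in> borel_measurable M" using sM by (simp cong: measurable_cong_sets)
  have i\<psi>: "integrable M \<psi>" using bd by (intro M.integrable_const_bound[of _ B]) auto
  have \<Phi>[measurable]: "(\<lambda>x. \<Sum>i<N. \<psi> (x i)) \<in> borel_measurable (sphere_space N)"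
    by (rule sphere_sum_measurable[OF \<psi>])
  have \<Phi>b: "\<bar>\<Sum>i<N. \<psi> (x i)\<bar> \<le> real N * B" for x
    by (rule abs_sum_coordinates_le[OF bd])
  have i1: "integrable ?P (\<lambda>x. \<psi> (x i))" if "i < N" for i
    using that by (intro integrable_PiM_component M i\<psi>) auto
  have ind: "integrable ?P (indicator X :: _ \<Rightarrow> real)"
    using X by (intro integrable_real_indicator) (auto simp: P.emeasure_eq_measure)
  have s1: "integrable ?P (\<lambda>x. \<Sum>i<N. \<psi> (x i))"
    using i1 by (intro Bochner_Integration.integrable_sum) auto
  have "(\<integral>x. (\<Sum>i<N. \<psi> (x i)) \<partial>?P) = (\<Sum>i<N. \<integral>x. \<psi> (x i) \<partial>?P)"
    using i1 by (intro Bochner_Integration.integral_sum) auto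
  also have "\<dots> = (\<Sum>i<N. \<integral>v. \<psi> v \<partial>M)"
    by (intro sum.cong refl integral_PiM_component M) auto
  finally have m1: "(\<integral>x. (\<Sum>i<N. \<psi> (x i)) \<partial>?P) = real N * (\<integral>v. \<psi> v \<partial>M)" by simp
  have "real N * ((\<integral>v. \<psi> v \<partial>M) - \<epsilon> - 2 * B * measure ?P X)
    = (\<integral>x. (\<Sum>i<N. \<psi> (x i)) - real N * \<epsilon> - 2 * B * real N * indicator X x \<partial>?P)"
    using s1 ind by (simp add: m1 P.prob_space algebra_simps)
  also have "\<dots> \<le> (\<integral>x. (\<Sum>i<N. \<psi> (radial_proj N x i)) \<partial>?P)"
  proof (rule integral_mono)
    show "integrable ?P (\<lambda>x. (\<Sum>i<N. \<psi> (x i)) - real N * \<epsilon> - 2 * B * real N * indicator X x)"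
      using s1 ind by auto
    show "integrable ?P (\<lambda>x. \<Sum>i<N. \<psi> (radial_proj N x i))"
      using \<Phi>b measurable_compose[OF pm \<Phi>] by (intro P.integrable_const_bound[of _ "real N * B"]) auto
    fix x assume x: "x \<in> space ?P"
    show "(\<Sum>i<N. \<psi> (x i)) - real N * \<epsilon> - 2 * B * real N * indicator X x \<le> (\<Sum>i<N. \<psi> (radial_proj N x i))"
    proof (cases "x \<in> X")
      case True
      have "0 \<le> real N * \<epsilon>" using \<epsilon> by simp
      moreover have "2 * B * real N * indicator X x = 2 * (real N * B)" using True by simp
      ultimately show ?thesis using \<Phi>b[of x] \<Phi>b[of "radial_proj N x"] by linarith
    next
      case False
      with x have "\<bar>sqnorm N x / real N - 1\<bar> \<le> \<eta>" by (auto simp: X_def)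
      from sum_radial_proj_close[OF N \<eta> dil this] False show ?thesis by (simp add: abs_le_iff)
    qed
  qed
  also have "\<dots> = (\<integral>x. (\<Sum>i<N. \<psi> (x i)) \<partial>projected_law M N)"
    unfolding projected_law_def by (rule integral_distr[OF pm \<Phi>, symmetric])
  finally show ?thesis by (simp add: X_def)
qed

lemma gauss_second_moment: "has_bochner_integral gauss_measure (\<lambda>v. v\<^sup>2) 1"
  unfolding gauss_measure_def
  using std_normal_moment_even[of 1]
  by (intro has_bochner_integral_density) (auto simp: fact_numeral)

text \<open>
  The Donsker-Varadhan inequality on the sphere is applied to \<open>x \<mapsto> \<Sum>i<N. \<psi> (x i)\<close>. Both sides
  grow linearly in \<open>N\<close>, and after division by \<open>N\<close> the errors are of order \<open>\<epsilon>\<close> as soon as the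
  shell carries at least half of the Gaussian mass and all but \<open>\<epsilon>\<close> of the mass of the product
  of \<open>M\<close>.
\<close>

lemma entropy_lower_bound_test:
  fixes M :: "real measure" and \<psi> :: "real \<Rightarrow> real"
  assumes M: "prob_space M" and sM: "sets M = sets borel" and m: "has_bochner_integral M (\<lambda>v. v\<^sup>2) 1"
    and ac: "absolutely_continuous gauss_measure M"
    and freq: "\<exists>\<^sub>F N in sequentially. rel_entropy (projected_law M N) (unif_sphere N) \<le> ereal (real N * c)"
    and cont: "continuous_on UNIV \<psi>" and supp: "\<And>x. R < \<bar>x\<bar> \<Longrightarrow> \<psi> x = 0" and R: "0 < R"
    and bd: "\<And>v. \<bar>\<psi> v\<bar> \<le> B"
  shows "(\<integral>v. \<psi> v \<partial>M) \<le> c + ln (\<integral>v. exp (\<psi> v) \<partial>gauss_measure)"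
proof (rule field_le_epsilon)
  fix \<epsilon>' :: real assume \<epsilon>': "0 < \<epsilon>'"
  have B0: "0 \<le> B" using bd[of 0] by linarith
  \<comment> \<open>Three errors of size \<open>\<epsilon>\<close> (two dilations and \<open>ln 2 / N\<close>) and one of size \<open>2 B \<epsilon>\<close> from the
      complement of the shell.\<close>
  define \<epsilon> where "\<epsilon> = \<epsilon>' / (3 + 2 * B)"
  have \<epsilon>: "0 < \<epsilon>" using \<epsilon>' B0 by (simp add: \<epsilon>_def)
  have \<psi>m[measurable]: "\<psi> \<in> borel_measurable borel" by (rule borel_measurable_continuous_onI[OF cont])
  obtain \<eta> where \<eta>: "0 < \<eta>" "\<eta> < 1"
    and dil: "\<And>t x. \<bar>t - 1\<bar> \<le> \<eta> \<Longrightarrow> \<bar>\<psi> (x / sqrt t) - \<psi> x\<bar> \<le> \<epsilon>"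
    using uniform_under_small_dilations[OF cont supp R \<epsilon>] by metis
  let ?q = "\<lambda>(M :: real measure) (N :: nat). measure (PiM {..<N} (\<lambda>_. M))
     {x \<in> space (PiM {..<N} (\<lambda>_. M)). \<eta> < \<bar>sqnorm N x / real N - 1\<bar>}"
  have "eventually (\<lambda>N. ?q M N < \<epsilon>) sequentially"
    using order_tendstoD(2)[OF sqnorm_shell_prob[OF M sM m \<eta>(1)] \<epsilon>] .
  moreover have "eventually (\<lambda>N. ?q gauss_measure N < 1 / 2) sequentially"
    using order_tendstoD(2)[OF sqnorm_shell_prob[OF prob_space_gauss_measure sets_gauss_measure gauss_second_moment \<eta>(1)], of "1 / 2"]
    by simp
  moreover have "eventually (\<lambda>N. ln 2 / real N < \<epsilon>) sequentially"
    using order_tendstoD(2)[OF lim_const_over_n[of "ln 2"] \<epsilon>] .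
  ultimately have "eventually (\<lambda>N. 0 < N \<and> ?q M N < \<epsilon> \<and> ?q gauss_measure N < 1 / 2 \<and> ln 2 / real N < \<epsilon>) sequentially"
    using eventually_gt_at_top[of 0] by eventually_elim auto
  from frequently_ex[OF frequently_eventually_conj[OF freq this]]
  obtain N where HN: "rel_entropy (projected_law M N) (unif_sphere N) \<le> ereal (real N * c)"
    and N: "0 < N" and qM: "?q M N < \<epsilon>" and qg: "?q gauss_measure N < 1 / 2" and l2: "ln 2 / real N < \<epsilon>"
    by blast
  let ?G = "gauss_prod N" and ?Z = "\<integral>v. exp (\<psi> v) \<partial>gauss_measure" and ?I = "\<integral>x. exp (\<Sum>i<N. \<psi> (x i)) \<partial>unif_sphere N"
  interpret G: prob_space ?G by (rule prob_space_gauss_prod)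
  interpret g: prob_space gauss_measure by (rule prob_space_gauss_measure)
  interpret S: prob_space "unif_sphere N" by (rule prob_space_unif_sphere)
  have [measurable]: "sqnorm N \<in> borel_measurable ?G" by (rule sqnorm_borel_measurable) simp
  define p where "p = measure ?G {x \<in> space ?G. \<bar>sqnorm N x / real N - 1\<bar> \<le> \<eta>}"
  have "p = 1 - measure ?G (space ?G - {x \<in> space ?G. \<bar>sqnorm N x / real N - 1\<bar> \<le> \<eta>})"
    unfolding p_def by (subst G.prob_compl) auto
  also have "space ?G - {x \<in> space ?G. \<bar>sqnorm N x / real N - 1\<bar> \<le> \<eta>} = {x \<in> space ?G. \<eta> < \<bar>sqnorm N x / real N - 1\<bar>}"
    by auto
  finally have p: "1 / 2 \<le> p" using qg by simp
  have \<Phi>S: "(\<lambda>x. \<Sum>i<N. \<psi> (x i)) \<in> borel_measurable (unif_sphere N)"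
    using sphere_sum_measurable[OF \<psi>m, of N] measurable_cong_sets[OF sets_unif_sphere refl] by blast
  have \<Phi>b: "\<bar>\<Sum>i<N. \<psi> (x i)\<bar> \<le> real N * B" for x
    by (rule abs_sum_coordinates_le[OF bd])
  have Z0: "0 < ?Z"
    by (rule g.exp_bounded_integral[OF _ bd]) (simp cong: measurable_cong_sets)
  have I0: "0 < ?I" by (rule S.exp_bounded_integral[OF \<Phi>S \<Phi>b])
  have "1 / 2 * ?I \<le> p * ?I" using p I0 by (intro mult_right_mono) auto
  also have "\<dots> \<le> exp (real N * \<epsilon>) * ?Z ^ N"
    unfolding p_def by (rule sphere_exp_moment_le[OF N _ bd \<eta>(2) dil]) measurable
  finally have "?I \<le> 2 * (exp (real N * \<epsilon>) * ?Z ^ N)" by simp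
  then have "ln ?I \<le> ln (2 * (exp (real N * \<epsilon>) * ?Z ^ N))"
    using I0 by (subst ln_le_cancel_iff) (auto intro: Z0)
  also have "\<dots> = ln 2 + real N * \<epsilon> + real N * ln ?Z"
    using Z0 by (simp add: ln_mult ln_realpow)
  finally have lnI: "ln ?I \<le> ln 2 + real N * \<epsilon> + real N * ln ?Z" .
  have "real N * ((\<integral>v. \<psi> v \<partial>M) - \<epsilon> - 2 * B * ?q M N) \<le> (\<integral>x. (\<Sum>i<N. \<psi> (x i)) \<partial>projected_law M N)"
    using \<epsilon> by (intro projected_law_mean_ge M sM N bd \<eta> dil) (auto simp: less_imp_le)
  also have "\<dots> \<le> real N * c + ln ?I"
    using sets_unif_sphere
    by (intro donsker_varadhan[OF prob_space_unif_sphere projected_law_prob[OF M sM] _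
          projected_law_absolutely_continuous[OF M sM ac N] HN \<Phi>S \<Phi>b])
       (simp add: projected_law_def)
  also have "\<dots> \<le> real N * c + (ln 2 + real N * \<epsilon> + real N * ln ?Z)" using lnI by simp
  also have "\<dots> = real N * (c + ln 2 / real N + \<epsilon> + ln ?Z)" using N by (simp add: field_simps)
  finally have "(\<integral>v. \<psi> v \<partial>M) - \<epsilon> - 2 * B * ?q M N \<le> c + ln 2 / real N + \<epsilon> + ln ?Z"
    using N by (simp add: mult_le_cancel_left_pos)
  moreover have "2 * B * ?q M N \<le> 2 * B * \<epsilon>" using qM B0 by (intro mult_left_mono) auto
  ultimately have "(\<integral>v. \<psi> v \<partial>M) \<le> c + ln ?Z + (3 + 2 * B) * \<epsilon>"
    using l2 by (simp add: algebra_simps)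
  also have "(3 + 2 * B) * \<epsilon> = \<epsilon>'" using B0 by (simp add: \<epsilon>_def)
  finally show "(\<integral>v. \<psi> v \<partial>M) \<le> c + ln ?Z + \<epsilon>'" .
qed

text \<open>
  A measurable function is an almost everywhere limit of continuous ones; clamping their values
  and multiplying by cutoffs that equal \<open>1\<close> on \<open>[-n, n]\<close> keeps the limit.
\<close>

lemma bounded_measurable_approx:
  fixes \<phi> :: "real \<Rightarrow> real"
  assumes \<phi>: "\<phi> \<in> borel_measurable borel" and bd: "\<And>v. \<bar>\<phi> v\<bar> \<le> B"
  obtains \<psi> :: "nat \<Rightarrow> real \<Rightarrow> real" where
    "\<And>n. continuous_on UNIV (\<psi> n)" "\<And>n x. real n + 1 < \<bar>x\<bar> \<Longrightarrow> \<psi> n x = 0"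
    "\<And>n x. \<bar>\<psi> n x\<bar> \<le> B" "AE x in lborel. (\<lambda>n. \<psi> n x) \<longlonglongrightarrow> \<phi> x"
proof -
  have B0: "0 \<le> B" using bd[of 0] by linarith
  have "\<phi> \<in> borel_measurable lebesgue" using \<phi> by (simp add: measurable_completion)
  then have "\<phi> measurable_on UNIV"
    using measurable_on_iff_borel_measurable[of UNIV \<phi>] by simp
  then obtain X g where X: "negligible X" and g: "\<And>n. continuous_on UNIV (g n)"
    and lim: "\<And>x. x \<notin> X \<Longrightarrow> (\<lambda>n. g n x) \<longlonglongrightarrow> \<phi> x"
    unfolding measurable_on_def by auto
  define k where "k n x = max 0 (min 1 (real n + 1 - \<bar>x\<bar>))" for n :: nat and x :: real
  define \<psi> where "\<psi> n x = k n x * max (- B) (min B (g n x))" for n x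
  have k: "0 \<le> k n x" "k n x \<le> 1" for n x by (auto simp: k_def)
  have c: "\<bar>max (- B) (min B (y::real))\<bar> \<le> B" for y using B0 by linarith
  have 1: "continuous_on UNIV (\<psi> n)" for n
    unfolding \<psi>_def k_def by (intro continuous_intros g)
  have 2: "\<psi> n x = 0" if "real n + 1 < \<bar>x\<bar>" for n x
    using that by (simp add: \<psi>_def k_def)
  have 3: "\<bar>\<psi> n x\<bar> \<le> B" for n x
    using mult_mono[OF k(2)[of n x] c[of "g n x"]] k[of n x] by (simp add: \<psi>_def abs_mult)
  have lim': "(\<lambda>n. \<psi> n x) \<longlonglongrightarrow> \<phi> x" if x: "x \<notin> X" for x
  proof -
    have "eventually (\<lambda>n. k n x = 1) sequentially"
      using eventually_ge_at_top[of "nat \<lceil>\<bar>x\<bar>\<rceil>"]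
    proof eventually_elim
      case (elim n)
      then have "\<bar>x\<bar> \<le> real n" by linarith
      then show ?case by (simp add: k_def)
    qed
    then have "(\<lambda>n. k n x) \<longlonglongrightarrow> 1" by (rule tendsto_eventually)
    then have "(\<lambda>n. \<psi> n x) \<longlonglongrightarrow> 1 * max (- B) (min B (\<phi> x))"
      unfolding \<psi>_def by (intro tendsto_intros lim x)
    also have "1 * max (- B) (min B (\<phi> x)) = \<phi> x" using bd[of x] by auto
    finally show ?thesis .
  qed
  have "AE x in lebesgue. x \<notin> X"
    using X by (intro AE_not_in) (simp add: negligible_iff_null_sets)
  then have "AE x in lebesgue. (\<lambda>n. \<psi> n x) \<longlonglongrightarrow> \<phi> x" by eventually_elim (rule lim')
  then have 4: "AE x in lborel. (\<lambda>n. \<psi> n x) \<longlonglongrightarrow> \<phi> x" by (simp add: AE_completion_iff)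
  show thesis by (rule that[of \<psi>]) (fact 1 2 3 4)+
qed

text \<open>
  Bounded measurable test functions, which determine the entropy, are reached from continuous
  compactly supported ones by dominated convergence. Since the
  hypothesis concerns infinitely many \<open>N\<close> and not all large ones, contraposition bounds the lower
  limit of the normalised entropies.
\<close>

lemma entropy_lower_bound:
  fixes f :: "real \<Rightarrow> real"
  defines "M \<equiv> density lborel (\<lambda>v. ennreal (f v))"
  assumes f[measurable]: "f \<in> borel_measurable borel"
    and M: "prob_space M" and m: "has_bochner_integral M (\<lambda>v. v\<^sup>2) 1"
    and ac: "absolutely_continuous gauss_measure M"
    and freq: "\<exists>\<^sub>F N in sequentially. rel_entropy (projected_law M N) (unif_sphere N) \<le> ereal (real N * c)"
  shows "rel_entropy M gauss_measure \<le> ereal c"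
proof (rule variational_upper_bound[OF prob_space_gauss_measure M _ ac])
  have sM: "sets M = sets borel" by (simp add: M_def)
  then show "sets M = sets gauss_measure" by simp
  interpret M: prob_space M by fact
  interpret g: prob_space gauss_measure by (rule prob_space_gauss_measure)
  fix \<phi> :: "real \<Rightarrow> real" and B
  assume "\<phi> \<in> borel_measurable gauss_measure" and bd: "\<And>x. \<bar>\<phi> x\<bar> \<le> B"
  then have \<phi>: "\<phi> \<in> borel_measurable borel" by (simp cong: measurable_cong_sets)
  obtain \<psi> :: "nat \<Rightarrow> real \<Rightarrow> real" where cont: "\<And>n. continuous_on UNIV (\<psi> n)"
    and supp: "\<And>n x. real n + 1 < \<bar>x\<bar> \<Longrightarrow> \<psi> n x = 0"
    and \<psi>b: "\<And>n x. \<bar>\<psi> n x\<bar> \<le> B" and lim: "AE x in lborel. (\<lambda>n. \<psi> n x) \<longlonglongrightarrow> \<phi> x"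
    using bounded_measurable_approx[OF \<phi> bd] by blast
  have \<psi>m: "\<psi> n \<in> borel_measurable borel" for n by (rule borel_measurable_continuous_onI[OF cont])
  have meas: "\<phi> \<in> borel_measurable M" "\<psi> n \<in> borel_measurable M"
    "\<phi> \<in> borel_measurable gauss_measure" "\<psi> n \<in> borel_measurable gauss_measure" for n
    using \<phi> \<psi>m sM by (simp_all cong: measurable_cong_sets)
  have limM: "AE x in M. (\<lambda>n. \<psi> n x) \<longlonglongrightarrow> \<phi> x"
    unfolding M_def using lim by (subst AE_density) auto
  have limg: "AE x in gauss_measure. (\<lambda>n. \<psi> n x) \<longlonglongrightarrow> \<phi> x"
    unfolding gauss_measure_def using lim by (subst AE_density) auto
  let ?Z = "\<integral>x. exp (\<phi> x) \<partial>gauss_measure"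
  have Z0: "0 < ?Z" by (rule g.exp_bounded_integral[OF meas(3) bd])
  have L: "(\<lambda>n. \<integral>x. \<psi> n x \<partial>M) \<longlonglongrightarrow> (\<integral>x. \<phi> x \<partial>M)"
    using meas limM \<psi>b by (intro integral_dominated_convergence[where w="\<lambda>_. B"]) auto
  have "(\<lambda>n. \<integral>x. exp (\<psi> n x) \<partial>gauss_measure) \<longlonglongrightarrow> ?Z"
  proof (rule integral_dominated_convergence[where w="\<lambda>_. exp B"])
    show "AE x in gauss_measure. (\<lambda>n. exp (\<psi> n x)) \<longlonglongrightarrow> exp (\<phi> x)"
      using limg by eventually_elim (intro tendsto_intros)
    show "AE x in gauss_measure. norm (exp (\<psi> n x)) \<le> exp B" for n
      using \<psi>b[of n] by (auto simp: abs_le_iff)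
  qed (use meas in auto)
  then have Rl: "(\<lambda>n. c + ln (\<integral>x. exp (\<psi> n x) \<partial>gauss_measure)) \<longlonglongrightarrow> c + ln ?Z"
    using Z0 by (intro tendsto_intros) auto
  have "(\<integral>x. \<psi> n x \<partial>M) \<le> c + ln (\<integral>x. exp (\<psi> n x) \<partial>gauss_measure)" for n
    by (rule entropy_lower_bound_test[OF M sM m ac freq cont supp _ \<psi>b]) auto
  then have "(\<integral>x. \<phi> x \<partial>M) \<le> c + ln ?Z"
    by (intro LIMSEQ_le[OF L Rl]) auto
  also have "ln ?Z \<le> ?Z - 1" using Z0 by (rule ln_le_minus_one)
  finally show "(\<integral>x. \<phi> x \<partial>M) \<le> c + ?Z - 1" by simp
qed

section \<open>Existence of entropically chaotic sequences\<close>

theorem theorem10: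
  fixes f :: "real \<Rightarrow> real"
  assumes "f \<in> borel_measurable borel"
    and "\<And>v. 0 \<le> f v"
    and "has_bochner_integral lborel f 1"
    and "has_bochner_integral lborel (\<lambda>v. f v * v\<^sup>2) 1"
    and "density_entropy f < \<infinity>"
  shows "\<exists>\<mu>N. entropically_chaotic (density lborel (\<lambda>v. ennreal (f v))) \<mu>N"
proof -
  note f[measurable] = assms(1) and f0 = assms(2)
  define M where "M = density lborel (\<lambda>v. ennreal (f v))"
  have sM: "sets M = sets borel" by (simp add: M_def)
  have M: "prob_space M"
  proof (rule prob_spaceI)
    have "emeasure M (space M) = (\<integral>\<^sup>+v. ennreal (f v) \<partial>lborel)"
      by (simp add: M_def emeasure_density cong: nn_integral_cong)
    also have "\<dots> = 1"
      using assms(3) f0 by (simp add: has_bochner_integral_iff nn_integral_eq_integral)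
    finally show "emeasure M (space M) = 1" .
  qed
  have m: "has_bochner_integral M (\<lambda>v. v\<^sup>2) 1"
    unfolding M_def using assms(4) f0 by (intro has_bochner_integral_density) auto
  have ac: "absolutely_continuous gauss_measure M"
    unfolding absolutely_continuous_def
  proof
    fix A assume "A \<in> null_sets gauss_measure"
    then have A: "A \<in> sets borel" and "AE v in lborel. v \<in> A \<longrightarrow> ennreal (std_normal_density v) = 0"
      unfolding gauss_measure_def by (auto simp: null_sets_density_iff)
    then have "AE v in lborel. v \<in> A \<longrightarrow> ennreal (f v) = 0"
      using normal_density_pos[of 1 0] by (auto simp: ennreal_eq_0_iff not_le[symmetric] elim!: eventually_mono)
    then show "A \<in> null_sets M" using A unfolding M_def by (subst null_sets_density_iff) auto
  qed
  let ?H = "rel_entropy M gauss_measure"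
  let ?h = "\<lambda>N. rel_entropy (projected_law M N) (unif_sphere N) / ereal (real N)"
  have div: "x / ereal (real N) \<le> ereal c \<longleftrightarrow> x \<le> ereal (real N * c)" if "0 < N" for x :: ereal and N c
    using that by (simp add: ereal_divide_le_pos)
  have up: "?h N \<le> ?H" if N: "0 < N" for N
  proof (rule ereal_le_real)
    fix c assume "?H \<le> ereal c"
    then show "?h N \<le> ereal c"
      unfolding div[OF N] by (rule projected_law_entropy_le[OF M sM ac N])
  qed
  have lim: "?h \<longlonglongrightarrow> ?H"
  proof (rule order_tendstoI)
    fix a assume "a < ?H"
    then obtain c where c: "a < ereal c" "ereal c < ?H" using ereal_dense2 by blast
    have "\<not> (\<exists>\<^sub>F N in sequentially. rel_entropy (projected_law M N) (unif_sphere N) \<le> ereal (real N * c))"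
      using entropy_lower_bound[OF f M[unfolded M_def] m[unfolded M_def] ac[unfolded M_def], of c] c(2)
      by (auto simp: M_def[symmetric])
    then have "eventually (\<lambda>N. \<not> rel_entropy (projected_law M N) (unif_sphere N) \<le> ereal (real N * c)) sequentially"
      by (simp add: not_frequently)
    then show "eventually (\<lambda>N. a < ?h N) sequentially"
      using eventually_gt_at_top[of 0]
    proof eventually_elim
      case (elim N)
      then have "\<not> ?h N \<le> ereal c" using div[of N] by blast
      with c(1) show ?case by simp
    qed
  next
    fix a assume "?H < a"
    show "eventually (\<lambda>N. ?h N < a) sequentially"
      using eventually_gt_at_top[of 0]
    proof eventually_elim
      case (elim N)
      from up[OF elim] \<open>?H < a\<close> show ?case by (rule le_less_trans)
    qed
  qed
  have sl: "sets (projected_law M N) = sets (sphere_space N)" for N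
    by (simp add: projected_law_def)
  have "entropically_chaotic M (projected_law M)"
    unfolding entropically_chaotic_def
    using M sM m lim sl
    by (auto intro: projected_law_prob projected_law_symmetric projected_law_chaotic)
  then show ?thesis unfolding M_def by blast
qed

end
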